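(* Let $\mathcal{C}$ be an abelian category with enough projectives and injectives. Then, for any (full) subcategory $\mathcal{D}\subseteq\mathcal{C}$ and any integer $n\ge1$, the following statements are equivalent: (a) $(\mathcal{D},\mathcal{D})$ is an $n$-cotorsion pair in $\mathcal{C}$. (b) $\mathcal{D}$ is an $(n+1)$-cluster tilting subcategory of $\mathcal{C}$. Moreover, in case (a) or (b) holds true, we have $\mathcal{C}=\mathcal{D}^\wedge_n=\mathcal{D}^\vee_n$.
   Context: ${}^{\perp_i}\mathcal{X}=\{C:\mathrm{Ext}^i_{\mathcal{C}}(C,X)=0\ \forall X\in\mathcal{X}\}$, $\mathcal{X}^{\perp_i}=\{C:\mathrm{Ext}^i_{\mathcal{C}}(X,C)=0\ \forall X\in\mathcal{X}\}$. $\mathcal{X}^\wedge_k$ (resp. $\mathcal{X}^\vee_k$) is the class of objects $C$ with an exact sequence $0\to X_k\to\cdots\to X_0\to C\to0$ (resp. $0\to C\to X_0\to\cdots\to X_k\to0$) of length at most $k$ with terms in $\mathcal{X}$. $n$-cotorsion pair $(\mathcal{A},\mathcal{B})$: $\mathcal{A}$ and $\mathcal{B}$ are closed under direct summands; $\mathrm{Ext}^i_{\mathcal{C}}(A,B)=0$ for all $A\in\mathcal{A}$, $B\in\mathcal{B}$, $1\le i\le n$; every $C\in\mathcal{C}$ fits in short exact sequences $0\to K\to A\to C\to0$ with $A\in\mathcal{A}$, $K\in\mathcal{B}^\wedge_{n-1}$, and $0\to C\to B\to L\to0$ with $B\in\mathcal{B}$, $L\in\mathcal{A}^\vee_{n-1}$.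 A class $\mathcal{D}$ is precovering if every object $C$ has a $\mathcal{D}$-precover, i.e. a morphism $D\to C$ with $D\in\mathcal{D}$ through which every morphism from an object of $\mathcal{D}$ to $C$ factors; preenveloping is dual. For $m\ge1$, $\mathcal{D}\subseteq\mathcal{C}$ is $m$-cluster tilting if it is precovering and preenveloping and $\mathcal{D}=\bigcap_{0<i<m}{}^{\perp_i}\mathcal{D}=\bigcap_{0<i<m}\mathcal{D}^{\perp_i}$. *)

theory Defs
  imports "HOL-Algebra.Elementary_Groups"
begin

section \<open>Abelian categories\<close>

text \<open>
  Arrows carry their domain and codomain. The operations are only meaningful on arguments of the
  right kind: composition on composable pairs (written as \<open>g \<cdot> f\<close> for first \<open>f\<close>, then \<open>g\<close>),
  addition on parallel pairs.
\<close>

record ('o, 'm) precat =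
  Obj :: "'o set"
  Arr :: "'m set"
  Dom :: "'m \<Rightarrow> 'o"
  Cod :: "'m \<Rightarrow> 'o"
  Id :: "'o \<Rightarrow> 'm"
  Comp :: "'m \<Rightarrow> 'm \<Rightarrow> 'm"  (infixl \<open>\<cdot>\<index>\<close> 70)
  Plus :: "'m \<Rightarrow> 'm \<Rightarrow> 'm"
  Zero :: "'o \<Rightarrow> 'o \<Rightarrow> 'm"

definition Hom :: "('o, 'm, 'x) precat_scheme \<Rightarrow> 'o \<Rightarrow> 'o \<Rightarrow> 'm set"
  where "Hom C a b = {f \<in> Arr C. Dom C f = a \<and> Cod C f = b}"

text \<open>The additive group of arrows from \<open>a\<close> to \<open>b\<close>, in the multiplicative notation of HOL-Algebra.\<close>

definition hom_group :: "('o, 'm, 'x) precat_scheme \<Rightarrow> 'o \<Rightarrow> 'o \<Rightarrow> 'm monoid"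
  where "hom_group C a b = \<lparr>carrier = Hom C a b, monoid.mult = Plus C, one = Zero C a b\<rparr>"

locale category =
  fixes C :: "('o, 'm, 'x) precat_scheme" (structure)
  assumes Dom_in: "f \<in> Arr C \<Longrightarrow> Dom C f \<in> Obj C"
    and Cod_in: "f \<in> Arr C \<Longrightarrow> Cod C f \<in> Obj C"
    and Id_in: "a \<in> Obj C \<Longrightarrow> Id C a \<in> Hom C a a"
    and Comp_in: "f \<in> Hom C a b \<Longrightarrow> g \<in> Hom C b c \<Longrightarrow> g \<cdot> f \<in> Hom C a c"
    and Comp_assoc:
      "f \<in> Hom C a b \<Longrightarrow> g \<in> Hom C b c \<Longrightarrow> h \<in> Hom C c d \<Longrightarrow> h \<cdot> g \<cdot> f = h \<cdot> (g \<cdot> f)"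
    and Comp_Id: "f \<in> Hom C a b \<Longrightarrow> f \<cdot> Id C a = f"
    and Id_Comp: "f \<in> Hom C a b \<Longrightarrow> Id C b \<cdot> f = f"

locale preadditive_category = category +
  assumes hom_comm_group: "a \<in> Obj C \<Longrightarrow> b \<in> Obj C \<Longrightarrow> comm_group (hom_group C a b)"
    and Comp_Plus: "f \<in> Hom C a b \<Longrightarrow> g \<in> Hom C b c \<Longrightarrow> h \<in> Hom C b c \<Longrightarrow>
      Plus C g h \<cdot> f = Plus C (g \<cdot> f) (h \<cdot> f)"
    and Plus_Comp: "f \<in> Hom C a b \<Longrightarrow> g \<in> Hom C a b \<Longrightarrow> h \<in> Hom C b c \<Longrightarrow>
      h \<cdot> Plus C f g = Plus C (h \<cdot> f) (h \<cdot> g)"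

definition is_zero_object :: "('o, 'm, 'x) precat_scheme \<Rightarrow> 'o \<Rightarrow> bool"
  where "is_zero_object C z \<longleftrightarrow>
    z \<in> Obj C \<and> (\<forall>a\<in>Obj C. (\<exists>!f. f \<in> Hom C z a) \<and> (\<exists>!f. f \<in> Hom C a z))"

text \<open>\<open>s\<close> is a biproduct of \<open>a\<close> and \<open>b\<close> with injections \<open>i, j\<close> and projections \<open>p, q\<close>.\<close>

definition is_biproduct ::
  "('o, 'm, 'x) precat_scheme \<Rightarrow> 'o \<Rightarrow> 'o \<Rightarrow> 'o \<Rightarrow> 'm \<Rightarrow> 'm \<Rightarrow> 'm \<Rightarrow> 'm \<Rightarrow> bool"
  where "is_biproduct C a b s i j p q \<longleftrightarrow>
    a \<in> Obj C \<and> b \<in> Obj C \<and> s \<in> Obj C \<and>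
    i \<in> Hom C a s \<and> j \<in> Hom C b s \<and> p \<in> Hom C s a \<and> q \<in> Hom C s b \<and>
    p \<cdot>\<^bsub>C\<^esub> i = Id C a \<and> q \<cdot>\<^bsub>C\<^esub> j = Id C b \<and> p \<cdot>\<^bsub>C\<^esub> j = Zero C b a \<and> q \<cdot>\<^bsub>C\<^esub> i = Zero C a b \<and>
    Plus C (i \<cdot>\<^bsub>C\<^esub> p) (j \<cdot>\<^bsub>C\<^esub> q) = Id C s"

locale additive_category = preadditive_category +
  assumes ex_zero_object: "\<exists>z. is_zero_object C z"
    and ex_biproduct: "a \<in> Obj C \<Longrightarrow> b \<in> Obj C \<Longrightarrow> \<exists>s i j p q. is_biproduct C a b s i j p q"

definition is_mono :: "('o, 'm, 'x) precat_scheme \<Rightarrow> 'm \<Rightarrow> bool"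
  where "is_mono C f \<longleftrightarrow> f \<in> Arr C \<and>
    (\<forall>a g h. g \<in> Hom C a (Dom C f) \<and> h \<in> Hom C a (Dom C f) \<and> f \<cdot>\<^bsub>C\<^esub> g = f \<cdot>\<^bsub>C\<^esub> h \<longrightarrow> g = h)"

definition is_epi :: "('o, 'm, 'x) precat_scheme \<Rightarrow> 'm \<Rightarrow> bool"
  where "is_epi C f \<longleftrightarrow> f \<in> Arr C \<and>
    (\<forall>a g h. g \<in> Hom C (Cod C f) a \<and> h \<in> Hom C (Cod C f) a \<and> g \<cdot>\<^bsub>C\<^esub> f = h \<cdot>\<^bsub>C\<^esub> f \<longrightarrow> g = h)"

definition is_kernel :: "('o, 'm, 'x) precat_scheme \<Rightarrow> 'm \<Rightarrow> 'm \<Rightarrow> bool"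
  where "is_kernel C k f \<longleftrightarrow> f \<in> Arr C \<and> k \<in> Arr C \<and> Cod C k = Dom C f \<and>
    f \<cdot>\<^bsub>C\<^esub> k = Zero C (Dom C k) (Cod C f) \<and>
    (\<forall>a x. x \<in> Hom C a (Dom C f) \<and> f \<cdot>\<^bsub>C\<^esub> x = Zero C a (Cod C f) \<longrightarrow>
      (\<exists>!y. y \<in> Hom C a (Dom C k) \<and> k \<cdot>\<^bsub>C\<^esub> y = x))"

definition is_cokernel :: "('o, 'm, 'x) precat_scheme \<Rightarrow> 'm \<Rightarrow> 'm \<Rightarrow> bool"
  where "is_cokernel C c f \<longleftrightarrow> f \<in> Arr C \<and> c \<in> Arr C \<and> Dom C c = Cod C f \<and>
    c \<cdot>\<^bsub>C\<^esub> f = Zero C (Dom C f) (Cod C c) \<and>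
    (\<forall>a x. x \<in> Hom C (Cod C f) a \<and> x \<cdot>\<^bsub>C\<^esub> f = Zero C (Dom C f) a \<longrightarrow>
      (\<exists>!y. y \<in> Hom C (Cod C c) a \<and> y \<cdot>\<^bsub>C\<^esub> c = x))"

locale abelian_category = additive_category +
  assumes ex_kernel: "f \<in> Arr C \<Longrightarrow> \<exists>k. is_kernel C k f"
    and ex_cokernel: "f \<in> Arr C \<Longrightarrow> \<exists>c. is_cokernel C c f"
    and mono_is_kernel: "is_mono C m \<Longrightarrow> \<exists>f. is_kernel C m f"
    and epi_is_cokernel: "is_epi C e \<Longrightarrow> \<exists>f. is_cokernel C e f"


section \<open>Exactness\<close>

definition is_image :: "('o, 'm, 'x) precat_scheme \<Rightarrow> 'm \<Rightarrow> 'm \<Rightarrow> bool"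
  where "is_image C m f \<longleftrightarrow> (\<exists>c. is_cokernel C c f \<and> is_kernel C m c)"

text \<open>
  Exactness of \<open>a \<rightarrow> b \<rightarrow> c\<close> (with arrows \<open>f\<close>, \<open>g\<close>) at \<open>b\<close>: the image of \<open>f\<close> and the kernel
  of \<open>g\<close> are the same subobject of \<open>b\<close>. Exactness of \<open>0 \<rightarrow> a \<rightarrow> b\<close> at \<open>a\<close> and of
  \<open>a \<rightarrow> b \<rightarrow> 0\<close> at \<open>b\<close> is expressed below by \<open>is_mono\<close> and \<open>is_epi\<close>.
\<close>

definition exact_at :: "('o, 'm, 'x) precat_scheme \<Rightarrow> 'm \<Rightarrow> 'm \<Rightarrow> bool"
  where "exact_at C f g \<longleftrightarrow> (\<exists>m. is_image C m f \<and> is_kernel C m g)"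

definition short_exact :: "('o, 'm, 'x) precat_scheme \<Rightarrow> 'm \<Rightarrow> 'm \<Rightarrow> bool"
  where "short_exact C f g \<longleftrightarrow> is_mono C f \<and> exact_at C f g \<and> is_epi C g"

text \<open>
  \<open>resolved_le C k X\<close> consists of the objects \<open>c\<close> with an exact sequence
  \<open>0 \<rightarrow> X\<^sub>m \<rightarrow> \<dots> \<rightarrow> X\<^sub>0 \<rightarrow> c \<rightarrow> 0\<close>, \<open>m \<le> k\<close>, with terms in \<open>X\<close>. Here
  \<open>d 0\<close> is the augmentation \<open>X\<^sub>0 \<rightarrow> c\<close> and \<open>d (i + 1)\<close> is the arrow \<open>X\<^sub>i\<^sub>+\<^sub>1 \<rightarrow> X\<^sub>i\<close>, so
  \<open>X\<^sub>i\<close> is the domain of \<open>d i\<close>. The definition of \<open>coresolved_le\<close> is dual.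
\<close>

definition resolved_le :: "('o, 'm, 'x) precat_scheme \<Rightarrow> nat \<Rightarrow> 'o set \<Rightarrow> 'o set"
  where "resolved_le C k X = {c \<in> Obj C. \<exists>m\<le>k. \<exists>d.
    Cod C (d 0) = c \<and> is_epi C (d 0) \<and>
    (\<forall>i\<le>m. Dom C (d i) \<in> X) \<and>
    (\<forall>i<m. exact_at C (d (Suc i)) (d i)) \<and>
    is_mono C (d m)}"

definition coresolved_le :: "('o, 'm, 'x) precat_scheme \<Rightarrow> nat \<Rightarrow> 'o set \<Rightarrow> 'o set"
  where "coresolved_le C k X = {c \<in> Obj C. \<exists>m\<le>k. \<exists>d.
    Dom C (d 0) = c \<and> is_mono C (d 0) \<and>
    (\<forall>i\<le>m. Cod C (d i) \<in> X) \<and>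
    (\<forall>i<m. exact_at C (d i) (d (Suc i))) \<and>
    is_epi C (d m)}"


section \<open>Projectives, injectives and Ext\<close>

definition is_projective :: "('o, 'm, 'x) precat_scheme \<Rightarrow> 'o \<Rightarrow> bool"
  where "is_projective C p \<longleftrightarrow> p \<in> Obj C \<and>
    (\<forall>e f. is_epi C e \<and> f \<in> Hom C p (Cod C e) \<longrightarrow> (\<exists>g \<in> Hom C p (Dom C e). e \<cdot>\<^bsub>C\<^esub> g = f))"

definition is_injective :: "('o, 'm, 'x) precat_scheme \<Rightarrow> 'o \<Rightarrow> bool"
  where "is_injective C q \<longleftrightarrow> q \<in> Obj C \<and>
    (\<forall>m f. is_mono C m \<and> f \<in> Hom C (Dom C m) q \<longrightarrow> (\<exists>g \<in> Hom C (Cod C m) q. g \<cdot>\<^bsub>C\<^esub> m = f))"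

definition enough_projectives :: "('o, 'm, 'x) precat_scheme \<Rightarrow> bool"
  where "enough_projectives C \<longleftrightarrow>
    (\<forall>a\<in>Obj C. \<exists>p e. is_projective C p \<and> e \<in> Hom C p a \<and> is_epi C e)"

definition enough_injectives :: "('o, 'm, 'x) precat_scheme \<Rightarrow> bool"
  where "enough_injectives C \<longleftrightarrow>
    (\<forall>a\<in>Obj C. \<exists>q m. is_injective C q \<and> m \<in> Hom C a q \<and> is_mono C m)"

text \<open>As above, \<open>d 0\<close> is the augmentation \<open>P\<^sub>0 \<rightarrow> a\<close>, and \<open>P\<^sub>i\<close> is the domain of \<open>d i\<close>.\<close>

definition projective_resolution ::
  "('o, 'm, 'x) precat_scheme \<Rightarrow> (nat \<Rightarrow> 'm) \<Rightarrow> 'o \<Rightarrow> bool"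
  where "projective_resolution C d a \<longleftrightarrow>
    Cod C (d 0) = a \<and> is_epi C (d 0) \<and>
    (\<forall>i. is_projective C (Dom C (d i))) \<and>
    (\<forall>i. exact_at C (d (Suc i)) (d i))"

text \<open>The cohomology of the cochain complex \<open>Hom (P\<^sub>0, b) \<rightarrow> Hom (P\<^sub>1, b) \<rightarrow> \<dots>\<close> in degree \<open>i\<close>.\<close>

definition ext_cocycles :: "('o, 'm, 'x) precat_scheme \<Rightarrow> (nat \<Rightarrow> 'm) \<Rightarrow> nat \<Rightarrow> 'o \<Rightarrow> 'm set"
  where "ext_cocycles C d i b =
    kernel (hom_group C (Dom C (d i)) b) (hom_group C (Dom C (d (Suc i))) b) (\<lambda>f. f \<cdot>\<^bsub>C\<^esub> d (Suc i))"

definition ext_coboundaries :: "('o, 'm, 'x) precat_scheme \<Rightarrow> (nat \<Rightarrow> 'm) \<Rightarrow> nat \<Rightarrow> 'o \<Rightarrow> 'm set"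
  where "ext_coboundaries C d i b =
    (case i of
      0 \<Rightarrow> {Zero C (Dom C (d 0)) b}
    | Suc j \<Rightarrow> (\<lambda>f. f \<cdot>\<^bsub>C\<^esub> d (Suc j)) ` Hom C (Dom C (d j)) b)"

definition ext_via :: "('o, 'm, 'x) precat_scheme \<Rightarrow> (nat \<Rightarrow> 'm) \<Rightarrow> nat \<Rightarrow> 'o \<Rightarrow> 'm set monoid"
  where "ext_via C d i b =
    (hom_group C (Dom C (d i)) b)\<lparr>carrier := ext_cocycles C d i b\<rparr> Mod ext_coboundaries C d i b"

text \<open>
  Meaningful in abelian categories with enough projectives, where a projective resolution of every
  object exists. Different resolutions yield isomorphic groups.
\<close>

definition Ext :: "('o, 'm, 'x) precat_scheme \<Rightarrow> nat \<Rightarrow> 'o \<Rightarrow> 'o \<Rightarrow> 'm set monoid"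
  where "Ext C i a b = ext_via C (SOME d. projective_resolution C d a) i b"

definition left_perp :: "('o, 'm, 'x) precat_scheme \<Rightarrow> nat \<Rightarrow> 'o set \<Rightarrow> 'o set"
  where "left_perp C i X = {c \<in> Obj C. \<forall>x\<in>X. trivial_group (Ext C i c x)}"

definition right_perp :: "('o, 'm, 'x) precat_scheme \<Rightarrow> nat \<Rightarrow> 'o set \<Rightarrow> 'o set"
  where "right_perp C i X = {c \<in> Obj C. \<forall>x\<in>X. trivial_group (Ext C i x c)}"


section \<open>Cotorsion pairs and cluster tilting\<close>

text \<open>Full subcategories are given by their sets of objects.\<close>

definition closed_under_summands :: "('o, 'm, 'x) precat_scheme \<Rightarrow> 'o set \<Rightarrow> bool"
  where "closed_under_summands C X \<longleftrightarrow>
    (\<forall>s\<in>X. \<forall>a b i j p q. is_biproduct C a b s i j p q \<longrightarrow> a \<in> X)"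

definition n_cotorsion_pair :: "('o, 'm, 'x) precat_scheme \<Rightarrow> nat \<Rightarrow> 'o set \<Rightarrow> 'o set \<Rightarrow> bool"
  where "n_cotorsion_pair C n A B \<longleftrightarrow>
    A \<subseteq> Obj C \<and> B \<subseteq> Obj C \<and>
    closed_under_summands C A \<and> closed_under_summands C B \<and>
    (\<forall>a\<in>A. \<forall>b\<in>B. \<forall>i. 1 \<le> i \<and> i \<le> n \<longrightarrow> trivial_group (Ext C i a b)) \<and>
    (\<forall>c\<in>Obj C. \<exists>f g. short_exact C f g \<and>
      Dom C f \<in> resolved_le C (n - 1) B \<and> Dom C g \<in> A \<and> Cod C g = c) \<and>
    (\<forall>c\<in>Obj C. \<exists>f g. short_exact C f g \<and>
      Dom C f = c \<and> Cod C f \<in> B \<and> Cod C g \<in> coresolved_le C (n - 1) A)"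

definition precovering :: "('o, 'm, 'x) precat_scheme \<Rightarrow> 'o set \<Rightarrow> bool"
  where "precovering C X \<longleftrightarrow>
    (\<forall>c\<in>Obj C. \<exists>x\<in>X. \<exists>f \<in> Hom C x c.
      \<forall>y\<in>X. \<forall>g \<in> Hom C y c. \<exists>h \<in> Hom C y x. f \<cdot>\<^bsub>C\<^esub> h = g)"

definition preenveloping :: "('o, 'm, 'x) precat_scheme \<Rightarrow> 'o set \<Rightarrow> bool"
  where "preenveloping C X \<longleftrightarrow>
    (\<forall>c\<in>Obj C. \<exists>x\<in>X. \<exists>f \<in> Hom C c x.
      \<forall>y\<in>X. \<forall>g \<in> Hom C c y. \<exists>h \<in> Hom C x y. h \<cdot>\<^bsub>C\<^esub> f = g)"

text \<open>
  The intersections are taken inside \<open>Obj C\<close>: for \<open>m = 1\<close> the index set is empty and the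
  intersection is the whole category.
\<close>

definition cluster_tilting :: "('o, 'm, 'x) precat_scheme \<Rightarrow> nat \<Rightarrow> 'o set \<Rightarrow> bool"
  where "cluster_tilting C m X \<longleftrightarrow>
    precovering C X \<and> preenveloping C X \<and>
    X = Obj C \<inter> (\<Inter>i\<in>{0<..<m}. left_perp C i X) \<and>
    X = Obj C \<inter> (\<Inter>i\<in>{0<..<m}. right_perp C i X)"

end

theory Submission
  imports Defs
begin

text \<open>
  Both notions split into two halves exchanged by passing to the opposite category, so only one
  half of each implication is proved. This needs the symmetry of Ext: for a projective resolution
  of \<open>a\<close> and an injective coresolution of \<open>b\<close>, dimension shifting along the cosyzygies of \<open>b\<close>
  shows that both compute the vanishing of \<open>Ext\<^sup>i (a, b)\<close>. After that, only the exactness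
  of \<open>Ext\<close> in its second argument is used, which is checked on cocycles of one fixed resolution.

  If \<open>(D, D)\<close> is an \<open>n\<close>-cotorsion pair and \<open>Ext\<^sup>i (c, D) = 0\<close> for \<open>1 \<le> i \<le> n\<close>, then
  \<open>Ext\<^sup>1 (c, K) = 0\<close> for \<open>K \<in> D\<^sup>\<and>\<^sub>n\<^sub>-\<^sub>1\<close>; hence the approximations are precovers, and the one of
  such a \<open>c\<close> splits. Conversely, the kernel of a \<open>D\<close>-precover of \<open>c\<close> satisfies one more
  condition \<open>Ext\<^sup>i (D, -) = 0\<close> than \<open>c\<close>, so that \<open>n\<close> successive precovers resolve \<open>c\<close> by \<open>D\<close>.
\<close>

section \<open>Duality\<close>

text \<open>Further record fields are dropped, so \<open>op_cat (op_cat C)\<close> need not be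
  \<open>C\<close> itself. Duality is therefore transferred by simp rules, one for each
  notion.\<close>

definition op_cat :: "('o, 'm, 'x) precat_scheme \<Rightarrow> ('o, 'm) precat"
  where "op_cat C = \<lparr>Obj = Obj C, Arr = Arr C, Dom = Cod C, Cod = Dom C, Id = Id C,
    Comp = (\<lambda>g f. f \<cdot>\<^bsub>C\<^esub> g), Plus = Plus C, Zero = (\<lambda>a b. Zero C b a)\<rparr>"

lemma op_cat_simps [simp]:
  "Obj (op_cat C) = Obj C" "Arr (op_cat C) = Arr C" "Dom (op_cat C) = Cod C"
  "Cod (op_cat C) = Dom C" "Id (op_cat C) = Id C" "g \<cdot>\<^bsub>op_cat C\<^esub> f = f \<cdot>\<^bsub>C\<^esub> g"
  "Plus (op_cat C) = Plus C" "Zero (op_cat C) a b = Zero C b a"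
  by (simp_all add: op_cat_def)

lemma Hom_op [simp]: "Hom (op_cat C) a b = Hom C b a"
  by (auto simp: Hom_def)

lemma hom_group_op [simp]: "hom_group (op_cat C) a b = hom_group C b a"
  by (simp add: hom_group_def)

lemma is_mono_op [simp]: "is_mono (op_cat C) f \<longleftrightarrow> is_epi C f"
  and is_epi_op [simp]: "is_epi (op_cat C) f \<longleftrightarrow> is_mono C f"
  by (simp_all add: is_mono_def is_epi_def)

lemma is_kernel_op [simp]: "is_kernel (op_cat C) k f \<longleftrightarrow> is_cokernel C k f"
  and is_cokernel_op [simp]: "is_cokernel (op_cat C) k f \<longleftrightarrow> is_kernel C k f"
  by (simp_all add: is_kernel_def is_cokernel_def)

lemma is_projective_op [simp]: "is_projective (op_cat C) a \<longleftrightarrow> is_injective C a"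
  and is_injective_op [simp]: "is_injective (op_cat C) a \<longleftrightarrow> is_projective C a"
  by (simp_all add: is_projective_def is_injective_def)

lemma enough_projectives_op [simp]: "enough_projectives (op_cat C) \<longleftrightarrow> enough_injectives C"
  and enough_injectives_op [simp]: "enough_injectives (op_cat C) \<longleftrightarrow> enough_projectives C"
  by (simp_all add: enough_projectives_def enough_injectives_def)

lemma is_zero_object_op [simp]: "is_zero_object (op_cat C) z \<longleftrightarrow> is_zero_object C z"
  by (auto simp: is_zero_object_def)

lemma is_biproduct_op [simp]:
  "is_biproduct (op_cat C) a b s i j p q \<longleftrightarrow> is_biproduct C a b s p q i j"
  by (auto simp: is_biproduct_def)

lemma closed_under_summands_op [simp]:
  "closed_under_summands (op_cat C) X \<longleftrightarrow> closed_under_summands C X"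
  unfolding closed_under_summands_def is_biproduct_op by blast

lemma precovering_op [simp]: "precovering (op_cat C) X \<longleftrightarrow> preenveloping C X"
  by (simp add: precovering_def preenveloping_def)

lemma (in category) category_op: "category (op_cat C)"
proof (unfold_locales, unfold op_cat_simps Hom_op)
  show "h \<cdot> (g \<cdot> f) = h \<cdot> g \<cdot> f"
    if "h \<in> Hom C c d" "g \<in> Hom C b c" "f \<in> Hom C a b" for f g h a b c d
    using that Comp_assoc by metis
qed (fact Dom_in Cod_in Id_in Comp_Id Id_Comp | erule (1) Comp_in[rotated])+

lemma (in preadditive_category) preadditive_op: "preadditive_category (op_cat C)"
  by (intro preadditive_category.intro preadditive_category_axioms.intro category_op,
      unfold op_cat_simps Hom_op hom_group_op)
    (fact hom_comm_group Comp_Plus Plus_Comp | erule (1) hom_comm_group[rotated]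
      | erule (2) Comp_Plus[rotated 2] Plus_Comp[rotated 2])+

lemma (in additive_category) additive_op: "additive_category (op_cat C)"
proof (intro additive_category.intro additive_category_axioms.intro preadditive_op)
  show "\<exists>z. is_zero_object (op_cat C) z"
    using ex_zero_object by simp
  show "\<exists>s i j p q. is_biproduct (op_cat C) a b s i j p q"
    if "a \<in> Obj (op_cat C)" "b \<in> Obj (op_cat C)" for a b
    using that ex_biproduct[of a b] unfolding is_biproduct_op op_cat_simps by metis
qed

lemma (in abelian_category) abelian_op: "abelian_category (op_cat C)"
  by (intro abelian_category.intro abelian_category_axioms.intro additive_op,
      unfold op_cat_simps is_kernel_op is_cokernel_op is_mono_op is_epi_op)
    (fact ex_kernel ex_cokernel mono_is_kernel epi_is_cokernel)+

section \<open>Additive calculus\<close>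

context category
begin

lemma HomI: "f \<in> Arr C \<Longrightarrow> f \<in> Hom C (Dom C f) (Cod C f)"
  by (simp add: Hom_def)

lemma HomD:
  assumes "f \<in> Hom C a b"
  shows "f \<in> Arr C" "Dom C f = a" "Cod C f = b" "a \<in> Obj C" "b \<in> Obj C"
  using assms Dom_in[of f] Cod_in[of f] by (auto simp: Hom_def)

lemma mono_cancel:
  assumes "is_mono C m" "m \<in> Hom C b c" "x \<in> Hom C a b" "y \<in> Hom C a b" "m \<cdot> x = m \<cdot> y"
  shows "x = y"
  using assms HomD(2)[OF assms(2)] unfolding is_mono_def by blast

lemma epi_cancel:
  assumes "is_epi C e" "e \<in> Hom C a b" "x \<in> Hom C b c" "y \<in> Hom C b c" "x \<cdot> e = y \<cdot> e"
  shows "x = y"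
  using assms HomD(3)[OF assms(2)] unfolding is_epi_def by blast

lemma epi_comp:
  assumes "is_epi C e" "is_epi C e'" "e \<in> Hom C a b" "e' \<in> Hom C b c"
  shows "is_epi C (e' \<cdot> e)"
  unfolding is_epi_def
proof (intro conjI allI impI, goal_cases)
  case 1
  then show ?case using HomD(1)[OF Comp_in[OF assms(3,4)]] .
next
  case (2 z x y)
  have "Cod C (e' \<cdot> e) = c" using HomD(3)[OF Comp_in[OF assms(3,4)]] .
  with 2 have xy: "x \<in> Hom C c z" "y \<in> Hom C c z" by auto
  then have "x \<cdot> e' \<cdot> e = y \<cdot> e' \<cdot> e"
    using 2(1) Comp_assoc[OF assms(3,4)] by simp
  then have "x \<cdot> e' = y \<cdot> e'"
    using epi_cancel[OF assms(1,3)] Comp_in[OF assms(4)] xy by blast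
  then show ?case using epi_cancel[OF assms(2,4)] xy by blast
qed

lemma epi_of_comp:
  assumes "is_epi C (f \<cdot> e)" "e \<in> Hom C a b" "f \<in> Hom C b c"
  shows "is_epi C f"
  unfolding is_epi_def
proof (intro conjI allI impI, goal_cases)
  case 1
  then show ?case using HomD(1)[OF assms(3)] .
next
  case (2 z x y)
  have "Cod C f = c" using HomD(3)[OF assms(3)] .
  with 2 have xy: "x \<in> Hom C c z" "y \<in> Hom C c z" by auto
  then have "x \<cdot> (f \<cdot> e) = y \<cdot> (f \<cdot> e)"
    using 2(1) Comp_assoc[OF assms(2,3) xy(1)] Comp_assoc[OF assms(2,3) xy(2)] by simp
  then show ?case using epi_cancel[OF assms(1) Comp_in[OF assms(2,3)]] xy by blast
qed

lemma mono_comp: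
  assumes "is_mono C m" "is_mono C m'" "m \<in> Hom C a b" "m' \<in> Hom C b c"
  shows "is_mono C (m' \<cdot> m)"
  using category.epi_comp[OF category_op, of m' m c b a] assms by simp

lemma mono_of_comp:
  assumes "is_mono C (m \<cdot> f)" "f \<in> Hom C a b" "m \<in> Hom C b c"
  shows "is_mono C f"
  using category.epi_of_comp[OF category_op, of f m c b a] assms by simp

end

context preadditive_category
begin

lemma Zero_in: "a \<in> Obj C \<Longrightarrow> b \<in> Obj C \<Longrightarrow> Zero C a b \<in> Hom C a b"
  using comm_group.axioms(2)[OF hom_comm_group[of a b]] group.is_monoid monoid.one_closed
  by (fastforce simp: hom_group_def)

lemma Plus_Zero: 
  assumes "f \<in> Hom C a b"
  shows "Plus C f (Zero C a b) = f" "Plus C (Zero C a b) f = f"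
proof -
  interpret comm_group "hom_group C a b" using hom_comm_group HomD(4,5)[OF assms(1)] by blast
  show "Plus C f (Zero C a b) = f" "Plus C (Zero C a b) f = f"
    using r_one[of f] l_one[of f] assms by (simp_all add: hom_group_def)
qed

lemma Plus_right_cancel: 
  assumes "f \<in> Hom C a b" "g \<in> Hom C a b" "h \<in> Hom C a b" "Plus C f h = Plus C g h"
  shows "f = g"
proof -
  interpret comm_group "hom_group C a b" using hom_comm_group HomD(4,5)[OF assms(1)] by blast
  show ?thesis using right_cancel[of h f g] assms by (simp add: hom_group_def)
qed

lemma Plus_eq_right: 
  assumes "f \<in> Hom C a b" "g \<in> Hom C a b" "Plus C f g = g"
  shows "f = Zero C a b"
  using Plus_right_cancel[OF assms(1) Zero_in assms(2)] assms Plus_Zero HomD(4,5) by metis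

text \<open>The record \<open>precat\<close> has no operation for negatives. Differences enter the
  later arguments in this additive form.\<close>

lemma subtract:
  assumes "f \<in> Hom C a b" "g \<in> Hom C a b"
  obtains h where "h \<in> Hom C a b" "f = Plus C h g"
proof -
  interpret comm_group "hom_group C a b" using hom_comm_group HomD(4,5)[OF assms(1)] by blast
  let ?h = "f \<otimes>\<^bsub>hom_group C a b\<^esub> inv\<^bsub>hom_group C a b\<^esub> g"
  have c: "f \<in> carrier (hom_group C a b)" "g \<in> carrier (hom_group C a b)"
    using assms by (auto simp: hom_group_def)
  then have "?h \<in> carrier (hom_group C a b)" "?h \<otimes>\<^bsub>hom_group C a b\<^esub> g = f"
    by (simp_all add: m_assoc)
  then show thesis using that by (auto simp: hom_group_def)
qed

text \<open>Since 0 + 0 = 0, the composite is its own double, and cancellation makes it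
  zero.\<close>

lemma Zero_Comp:
  assumes "f \<in> Hom C a b" "c \<in> Obj C"
  shows "Zero C b c \<cdot> f = Zero C a c"
proof -
  have z: "Zero C b c \<in> Hom C b c" using Zero_in HomD(5) assms by blast
  have "Plus C (Zero C b c \<cdot> f) (Zero C b c \<cdot> f) = Plus C (Zero C b c) (Zero C b c) \<cdot> f"
    using Comp_Plus[OF assms(1) z z] by simp
  then show ?thesis
    using Plus_eq_right[OF Comp_in[OF assms(1) z] Comp_in[OF assms(1) z]] Plus_Zero z by simp
qed

lemma Comp_Zero:
  assumes "f \<in> Hom C b c" "a \<in> Obj C"
  shows "f \<cdot> Zero C a b = Zero C a c"
  using preadditive_category.Zero_Comp[OF preadditive_op, of f c b a] assms by simp

text \<open>Two arrows identified by \<open>m\<close> have a difference \<open>z\<close> killed by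
  \<open>m\<close>, so trivial kernel suffices.\<close>

lemma monoI:
  assumes "m \<in> Hom C b c"
    and "\<And>a x. x \<in> Hom C a b \<Longrightarrow> m \<cdot> x = Zero C a c \<Longrightarrow> x = Zero C a b"
  shows "is_mono C m"
  unfolding is_mono_def
proof (intro conjI allI impI, goal_cases)
  case 1
  then show ?case using HomD(1)[OF assms(1)] .
next
  case (2 a x y)
  then have xy: "x \<in> Hom C a b" "y \<in> Hom C a b" "m \<cdot> x = m \<cdot> y" using HomD[OF assms(1)] by auto
  obtain z where z: "z \<in> Hom C a b" "x = Plus C z y" using subtract xy by blast
  have "Plus C (m \<cdot> z) (m \<cdot> y) = m \<cdot> y"
    using z xy Plus_Comp[OF z(1) xy(2) assms(1)] by simp
  then have "m \<cdot> z = Zero C a c" using Plus_eq_right Comp_in assms(1) z xy by meson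
  then have "z = Zero C a b" using assms(2) z by blast
  then show ?case using z xy Plus_Zero by simp
qed

end

section \<open>Kernels, cokernels and exactness\<close>

context preadditive_category
begin

lemma kernelD:
  assumes "is_kernel C k f" "f \<in> Hom C b c"
  shows "k \<in> Hom C (Dom C k) b" "f \<cdot> k = Zero C (Dom C k) c" "is_mono C k"
proof -
  show 1: "k \<in> Hom C (Dom C k) b" "f \<cdot> k = Zero C (Dom C k) c"
    using assms unfolding is_kernel_def Hom_def by auto
  show "is_mono C k"
    unfolding is_mono_def
  proof (intro conjI allI impI, goal_cases)
    case 1
    then show ?case using assms unfolding is_kernel_def by auto
  next
    case (2 a x y)
    then have x: "x \<in> Hom C a (Dom C k)" by blast
    have "f \<cdot> (k \<cdot> x) = Zero C a c"
      using Comp_assoc[OF x 1(1) assms(2)] 1(2) Zero_Comp[OF x HomD(5)[OF assms(2)]] by simp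
    moreover have "Dom C f = b" "Cod C f = c" using HomD[OF assms(2)] by auto
    ultimately have "\<exists>!y. y \<in> Hom C a (Dom C k) \<and> k \<cdot> y = k \<cdot> x"
      using assms(1) Comp_in[OF x 1(1)] unfolding is_kernel_def by blast
    then show ?case using 2 by auto
  qed
qed

lemma kernel_lift:
  assumes "is_kernel C k f" "f \<in> Hom C b c" "x \<in> Hom C a b" "f \<cdot> x = Zero C a c"
  obtains y where "y \<in> Hom C a (Dom C k)" "k \<cdot> y = x"
proof -
  have "Dom C f = b" "Cod C f = c" using assms HomD by auto
  then show thesis using that assms unfolding is_kernel_def by blast
qed

text \<open>Uniqueness of the factorization comes from \<open>k\<close> being mono; only existence
  is left to the user.\<close>

lemma kernelI:
  assumes "f \<in> Hom C b c" "k \<in> Hom C d b" "is_mono C k" "f \<cdot> k = Zero C d c"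
    and "\<And>a x. x \<in> Hom C a b \<Longrightarrow> f \<cdot> x = Zero C a c \<Longrightarrow> \<exists>y. y \<in> Hom C a d \<and> k \<cdot> y = x"
  shows "is_kernel C k f"
proof -
  have *: "f \<in> Arr C" "k \<in> Arr C" "Dom C f = b" "Cod C f = c" "Dom C k = d" "Cod C k = b"
    using HomD assms by auto
  show ?thesis
    unfolding is_kernel_def *
  proof (intro conjI allI impI *(1,2) refl assms(4))
    fix a x
    assume "x \<in> Hom C a b \<and> f \<cdot> x = Zero C a c"
    then obtain y where "y \<in> Hom C a d" "k \<cdot> y = x" using assms(5) by blast
    then show "\<exists>!y. y \<in> Hom C a d \<and> k \<cdot> y = x"
      using mono_cancel[OF assms(3,2)] by blast
  qed
qed

lemma cokernelD:
  assumes "is_cokernel C k f" "f \<in> Hom C a b"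
  shows "k \<in> Hom C b (Cod C k)" "k \<cdot> f = Zero C a (Cod C k)" "is_epi C k"
  using preadditive_category.kernelD[OF preadditive_op, of k f b a, unfolded op_cat_simps
      Hom_op is_kernel_op is_mono_op, OF assms] .

lemma cokernel_extend:
  assumes "is_cokernel C k f" "f \<in> Hom C a b" "x \<in> Hom C b c" "x \<cdot> f = Zero C a c"
  obtains y where "y \<in> Hom C (Cod C k) c" "y \<cdot> k = x"
  using preadditive_category.kernel_lift[OF preadditive_op, of k f b a x c, unfolded op_cat_simps
      Hom_op is_kernel_op, OF assms] that by blast

lemma cokernelI:
  assumes "f \<in> Hom C a b" "k \<in> Hom C b d" "is_epi C k" "k \<cdot> f = Zero C a d"
    and ex: "\<And>c x. x \<in> Hom C b c \<Longrightarrow> x \<cdot> f = Zero C a c \<Longrightarrow> \<exists>y. y \<in> Hom C d c \<and> y \<cdot> k = x"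
  shows "is_cokernel C k f"
  using preadditive_category.kernelI[OF preadditive_op, of f b a k d, unfolded op_cat_simps
      Hom_op is_mono_op is_kernel_op, OF assms(1-4) ex] .

end

lemma kernel_arr:
  assumes "is_kernel C k f"
  shows "k \<in> Arr C" "f \<in> Arr C" "Cod C k = Dom C f"
  using assms unfolding is_kernel_def by blast+

lemma cokernel_arr:
  assumes "is_cokernel C k f"
  shows "k \<in> Arr C" "f \<in> Arr C" "Dom C k = Cod C f"
  using assms unfolding is_cokernel_def by blast+

lemma exact_at_iff_kernel:
  "exact_at C f g \<longleftrightarrow> (\<exists>m c. is_cokernel C c f \<and> is_kernel C m c \<and> is_kernel C m g)"
  unfolding exact_at_def is_image_def by blast

section \<open>Exactness in an abelian category: self-duality, monos and epis, image
  factorization\<close>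

context abelian_category
begin

text \<open>By the axioms \<open>c\<close> is a cokernel of some \<open>f\<close>, and
  \<open>f\<close> factors through the kernel \<open>m\<close> of \<open>c\<close>. Hence an arrow
  that kills \<open>m\<close> also kills \<open>f\<close> and extends along
  \<open>c\<close>.\<close>

lemma epi_is_cokernel_of_kernel:
  assumes "is_epi C c" "is_kernel C m c"
  shows "is_cokernel C c m"
proof -
  have c: "c \<in> Hom C (Dom C c) (Cod C c)"
    using assms(1) HomI unfolding is_epi_def by blast
  note m = kernelD[OF assms(2) c]
  obtain f where f: "is_cokernel C c f" using epi_is_cokernel assms(1) by blast
  have fh: "f \<in> Hom C (Dom C f) (Dom C c)" 
    using f HomI[of f] unfolding is_cokernel_def by simp
  obtain y where y: "y \<in> Hom C (Dom C f) (Dom C m)" "m \<cdot> y = f"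
    using kernel_lift[OF assms(2) c fh] cokernelD(2)[OF f fh] by blast
  show ?thesis
  proof (rule cokernelI[OF m(1) c assms(1) m(2)])
    fix z x
    assume x: "x \<in> Hom C (Dom C c) z" "x \<cdot> m = Zero C (Dom C m) z"
    have "x \<cdot> f = Zero C (Dom C f) z"
      using Comp_assoc[OF y(1) m(1) x(1)] x(2) y(2) Zero_Comp[OF y(1) HomD(5)[OF x(1)]] by simp
    then show "\<exists>y. y \<in> Hom C (Cod C c) z \<and> y \<cdot> c = x"
      using cokernel_extend[OF f fh x(1)] by blast
  qed
qed

lemma mono_is_kernel_of_cokernel:
  assumes "is_mono C m" "is_cokernel C c m"
  shows "is_kernel C m c"
  using abelian_category.epi_is_cokernel_of_kernel[OF abelian_op, of m c] assms by simp

text \<open>The cokernel \<open>c\<close> of \<open>f\<close> is epi, hence a cokernel of its own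
  kernel \<open>m\<close>. With this clause added the condition is symmetric in \<open>f\<close> and
  \<open>g\<close>, from which \<open>exact_at_op\<close> follows.\<close>

lemma exact_at_iff:
  "exact_at C f g \<longleftrightarrow>
    (\<exists>m c. is_cokernel C c f \<and> is_kernel C m g \<and> is_kernel C m c \<and> is_cokernel C c m)"
proof
  assume "exact_at C f g"
  then obtain m c where mc: "is_cokernel C c f" "is_kernel C m c" "is_kernel C m g"
    unfolding exact_at_iff_kernel by blast
  have "f \<in> Hom C (Dom C f) (Cod C f)" using mc(1) HomI unfolding is_cokernel_def by blast
  then show "\<exists>m c. is_cokernel C c f \<and> is_kernel C m g \<and> is_kernel C m c \<and> is_cokernel C c m"
    using mc cokernelD(3) epi_is_cokernel_of_kernel by blast
qed (auto simp: exact_at_iff_kernel)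

lemma exact_at_op [simp]: "exact_at (op_cat C) f g \<longleftrightarrow> exact_at C g f"
  unfolding exact_at_iff abelian_category.exact_at_iff[OF abelian_op]
  by auto

lemma short_exact_op [simp]: "short_exact (op_cat C) f g \<longleftrightarrow> short_exact C g f"
  by (auto simp: short_exact_def)

lemma resolved_le_op [simp]: "resolved_le (op_cat C) k X = coresolved_le C k X"
  by (simp add: resolved_le_def coresolved_le_def)

lemma exact_atD:
  assumes "exact_at C f g"
  shows "f \<in> Hom C (Dom C f) (Dom C g)" "g \<in> Hom C (Dom C g) (Cod C g)"
    "g \<cdot> f = Zero C (Dom C f) (Cod C g)"
proof -
  obtain m c where mc: "is_cokernel C c f" "is_kernel C m g" "is_kernel C m c" "is_cokernel C c m"
    using assms unfolding exact_at_iff by blast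
  show f: "f \<in> Hom C (Dom C f) (Dom C g)" and g: "g \<in> Hom C (Dom C g) (Cod C g)"
    using HomI[of f] HomI[of g] cokernel_arr[OF mc(1)] kernel_arr[OF mc(2)] kernel_arr[OF mc(3)]
    by auto
  note m = kernelD[OF mc(2) g]
  note c = cokernelD[OF mc(1) f]
  \<comment> \<open>\<open>g\<close> kills its kernel \<open>m\<close>, so it factors through
    \<open>c\<close>, a cokernel of \<open>m\<close>; and \<open>c\<close> kills
    \<open>f\<close>.\<close>
  obtain y where y: "y \<in> Hom C (Cod C c) (Cod C g)" "y \<cdot> c = g"
    using cokernel_extend[OF mc(4) m(1) g m(2)] by blast
  show "g \<cdot> f = Zero C (Dom C f) (Cod C g)"
    using Comp_assoc[OF f c(1) y(1)] c(2) y(2) Comp_Zero[OF y(1) HomD(4)[OF f]] by simp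
qed

text \<open>A kernel is mono, hence a kernel of its cokernel, so it is its own image.\<close>

lemma exact_at_kernel:
  assumes "is_kernel C k g" "g \<in> Hom C b c"
  shows "exact_at C k g"
proof -
  note k = kernelD[OF assms]
  obtain q where q: "is_cokernel C q k" using ex_cokernel HomD(1)[OF k(1)] by blast
  then show ?thesis 
    using assms mono_is_kernel_of_cokernel[OF k(3)] unfolding exact_at_iff by blast
qed

text \<open>A mono \<open>f\<close> is a kernel of its cokernel \<open>c\<close>. An arrow killed by
  \<open>g\<close> factors through the common kernel \<open>m\<close> of \<open>g\<close> and
  \<open>c\<close>, so \<open>c\<close> kills it and it lifts along \<open>f\<close>.\<close>

lemma exact_mono_kernel:
  assumes "exact_at C f g" "is_mono C f"
  shows "is_kernel C f g"
proof -
  note e = exact_atD[OF assms(1)]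
  obtain m c where mc: "is_cokernel C c f" "is_kernel C m g" "is_kernel C m c" "is_cokernel C c m"
    using assms unfolding exact_at_iff by blast
  note m = kernelD[OF mc(2) e(2)]
  note c = cokernelD[OF mc(1) e(1)]
  note fc = mono_is_kernel_of_cokernel[OF assms(2) mc(1)]
  show ?thesis
  proof (rule kernelI[OF e(2,1) assms(2) e(3)])
    fix z x
    assume x: "x \<in> Hom C z (Dom C g)" "g \<cdot> x = Zero C z (Cod C g)"
    obtain y where y: "y \<in> Hom C z (Dom C m)" "m \<cdot> y = x"
      using kernel_lift[OF mc(2) e(2) x] .
    have "c \<cdot> x = Zero C z (Cod C c)"
      using kernelD[OF mc(3) c(1)] Comp_assoc[OF y(1) m(1) c(1)] y(2)
        Zero_Comp[OF y(1) HomD(5)[OF c(1)]] by simp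
    then show "\<exists>y. y \<in> Hom C z (Dom C f) \<and> f \<cdot> y = x"
      using kernel_lift[OF fc c(1) x(1)] by blast
  qed
qed

lemma exact_epi_cokernel:
  assumes "exact_at C f g" "is_epi C g"
  shows "is_cokernel C g f"
  using abelian_category.exact_mono_kernel[OF abelian_op, of g f] assms by simp

text \<open>Cancelling \<open>e\<close> shows that \<open>f \<cdot> e\<close> and \<open>f\<close>
  are killed by the same arrows out of \<open>c\<close>.\<close>

lemma cokernel_comp_epi:
  assumes "is_epi C e" "e \<in> Hom C a b" "f \<in> Hom C b c"
  shows "is_cokernel C q (f \<cdot> e) \<longleftrightarrow> is_cokernel C q f"
proof -
  note fe = Comp_in[OF assms(2,3)]
  have zero: "x \<cdot> (f \<cdot> e) = Zero C a d \<longleftrightarrow> x \<cdot> f = Zero C b d" if x: "x \<in> Hom C c d" for x d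
  proof -
    have "x \<cdot> f \<cdot> e = Zero C b d \<cdot> e \<longleftrightarrow> x \<cdot> f = Zero C b d"
      using epi_cancel[OF assms(1,2) Comp_in[OF assms(3) x] Zero_in] HomD(4)[OF assms(3)] HomD(5)[OF x]
      by auto
    then show ?thesis
      using Comp_assoc[OF assms(2,3) x] Zero_Comp[OF assms(2) HomD(5)[OF x]] by simp
  qed
  show ?thesis
  proof
    assume q: "is_cokernel C q (f \<cdot> e)"
    note qD = cokernelD[OF q fe]
    show "is_cokernel C q f"
    proof (rule cokernelI[OF assms(3) qD(1,3)])
      show "q \<cdot> f = Zero C b (Cod C q)" using qD(2) zero[OF qD(1)] by simp
      fix z x assume "x \<in> Hom C c z" "x \<cdot> f = Zero C b z"
      then show "\<exists>y. y \<in> Hom C (Cod C q) z \<and> y \<cdot> q = x"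
        using cokernel_extend[OF q fe, of x z] zero[of x z] by auto
    qed
  next
    assume q: "is_cokernel C q f"
    note qD = cokernelD[OF q assms(3)]
    show "is_cokernel C q (f \<cdot> e)"
    proof (rule cokernelI[OF fe qD(1,3)])
      show "q \<cdot> (f \<cdot> e) = Zero C a (Cod C q)" using qD(2) zero[OF qD(1)] by simp
      fix z x assume "x \<in> Hom C c z" "x \<cdot> (f \<cdot> e) = Zero C a z"
      then show "\<exists>y. y \<in> Hom C (Cod C q) z \<and> y \<cdot> q = x"
        using cokernel_extend[OF q assms(3), of x z] zero[of x z] by auto
    qed
  qed
qed

lemma exact_at_comp_epi:
  assumes "is_epi C e" "e \<in> Hom C a b" "f \<in> Hom C b c"
  shows "exact_at C (f \<cdot> e) g \<longleftrightarrow> exact_at C f g"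
  unfolding exact_at_def is_image_def cokernel_comp_epi[OF assms] ..

lemma exact_at_comp_mono:
  assumes "is_mono C m" "m \<in> Hom C b c" "g \<in> Hom C a b"
  shows "exact_at C f (m \<cdot> g) \<longleftrightarrow> exact_at C f g"
  using abelian_category.exact_at_comp_epi[OF abelian_op, of m c b g a f] assms by simp

text \<open>Image factorization through the cokernel of the kernel: if \<open>h \<cdot> x = 0\<close> and \<open>q\<close> is a cokernel
  of \<open>x\<close>, then the epi \<open>q \<cdot> e\<close> is a cokernel of some \<open>y\<close> killed by \<open>g\<close>, hence by \<open>e\<close>; so \<open>q\<close> is
  split mono and \<open>x = 0\<close>.\<close>

lemma exact_factor:
  assumes "exact_at C f g"
  obtains e m where "is_cokernel C e f" "is_epi C e" "is_mono C m"
    "e \<in> Hom C (Dom C g) (Cod C e)" "m \<in> Hom C (Cod C e) (Cod C g)" "g = m \<cdot> e"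
proof -
  note fg = exact_atD[OF assms]
  obtain k e where ke: "is_cokernel C e f" "is_kernel C k g" "is_kernel C k e" "is_cokernel C e k"
    using assms unfolding exact_at_iff by blast
  note k = kernelD[OF ke(2) fg(2)]
  note e = cokernelD[OF ke(1) fg(1)]
  let ?i = "Cod C e"
  obtain h where h: "h \<in> Hom C ?i (Cod C g)" "h \<cdot> e = g"
    using cokernel_extend[OF ke(4) k(1) fg(2) k(2)] .
  have "is_mono C h"
  proof (rule monoI[OF h(1)])
    fix z x
    assume x: "x \<in> Hom C z ?i" "h \<cdot> x = Zero C z (Cod C g)"
    obtain q where q: "is_cokernel C q x" using ex_cokernel HomD(1)[OF x(1)] by blast
    note qD = cokernelD[OF q x(1)]
    obtain h' where h': "h' \<in> Hom C (Cod C q) (Cod C g)" "h' \<cdot> q = h"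
      using cokernel_extend[OF q x(1) h(1) x(2)] .
    note qe = Comp_in[OF e(1) qD(1)]
    have qe_epi: "is_epi C (q \<cdot> e)" by (rule epi_comp[OF e(3) qD(3) e(1) qD(1)])
    obtain y where y: "is_kernel C y (q \<cdot> e)" using ex_kernel HomD(1)[OF qe] by blast
    note yD = kernelD[OF y qe]
    have "g \<cdot> y = h' \<cdot> (q \<cdot> e) \<cdot> y"
      using h'(2) h(2) Comp_assoc[OF e(1) qD(1) h'(1)] by simp
    also have "\<dots> = Zero C (Dom C y) (Cod C g)"
      using Comp_assoc[OF yD(1) qe h'(1)] yD(2) Comp_Zero[OF h'(1) HomD(4)[OF yD(1)]] by simp
    finally obtain w where w: "w \<in> Hom C (Dom C y) (Dom C k)" "k \<cdot> w = y"
      using kernel_lift[OF ke(2) fg(2) yD(1)] by blast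
    have "e \<cdot> y = Zero C (Dom C y) ?i"
      using Comp_assoc[OF w(1) k(1) e(1)] w(2) kernelD(2)[OF ke(3) e(1)]
        Zero_Comp[OF w(1) HomD(5)[OF e(1)]] by simp
    then obtain s where s: "s \<in> Hom C (Cod C (q \<cdot> e)) ?i" "s \<cdot> (q \<cdot> e) = e"
      using cokernel_extend[OF epi_is_cokernel_of_kernel[OF qe_epi y] yD(1) e(1)] by blast
    have s1: "s \<in> Hom C (Cod C q) ?i" using s(1) HomD(3)[OF qe] by simp
    have i: "?i \<in> Obj C" using HomD(5)[OF e(1)] .
    have "s \<cdot> q \<cdot> e = Id C ?i \<cdot> e"
      using s(2) Comp_assoc[OF e(1) qD(1) s1] Id_Comp[OF e(1)] by simp
    then have sq: "s \<cdot> q = Id C ?i"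
      using epi_cancel[OF e(3,1) Comp_in[OF qD(1) s1] Id_in[OF i]] by blast
    have "x = s \<cdot> q \<cdot> x" using sq Id_Comp[OF x(1)] by simp
    also have "\<dots> = s \<cdot> (q \<cdot> x)" using Comp_assoc[OF x(1) qD(1) s1] .
    also have "\<dots> = Zero C z ?i" using qD(2) Comp_Zero[OF s1 HomD(4)[OF x(1)]] by simp
    finally show "x = Zero C z ?i" .
  qed
  then show thesis using that[OF ke(1) e(3) _ e(1) h(1)] h(2) by simp
qed

text \<open>Dual of \<open>exact_factor\<close>: here the left arrow is factored, through the kernel
  of the right one.\<close>

lemma exact_cofactor:
  assumes "exact_at C f g"
  obtains e m where "is_kernel C m g" "is_epi C e" "is_mono C m"
    "m \<in> Hom C (Dom C m) (Dom C g)" "e \<in> Hom C (Dom C f) (Dom C m)" "f = m \<cdot> e"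
  using abelian_category.exact_factor[OF abelian_op, of g f thesis, unfolded exact_at_op
      is_cokernel_op is_epi_op is_mono_op op_cat_simps Hom_op
      HomD(3)[OF exact_atD(1)[OF assms]], OF assms] by blast

end

section \<open>Vanishing of Ext\<close>

text \<open>For \<open>i \<ge> 1\<close> this says that the \<open>i\<close>-th cohomology of \<open>Hom (P, b)\<close> is zero. For \<open>i = 0\<close> the
  codomain of \<open>d 0\<close> is the resolved object, and the condition always holds.\<close>

definition ext_vanish :: "('o, 'm, 'x) precat_scheme \<Rightarrow> (nat \<Rightarrow> 'm) \<Rightarrow> nat \<Rightarrow> 'o \<Rightarrow> bool"
  where "ext_vanish C d i b \<longleftrightarrow>
    (\<forall>f \<in> Hom C (Dom C (d i)) b. f \<cdot>\<^bsub>C\<^esub> d (Suc i) = Zero C (Dom C (d (Suc i))) b \<longrightarrow>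
      (\<exists>g \<in> Hom C (Cod C (d i)) b. g \<cdot>\<^bsub>C\<^esub> d i = f))"

lemma ext_vanishI:
  assumes "\<And>f. f \<in> Hom C (Dom C (d i)) b \<Longrightarrow> f \<cdot>\<^bsub>C\<^esub> d (Suc i) = Zero C (Dom C (d (Suc i))) b \<Longrightarrow>
    \<exists>g \<in> Hom C (Cod C (d i)) b. g \<cdot>\<^bsub>C\<^esub> d i = f"
  shows "ext_vanish C d i b"
  using assms unfolding ext_vanish_def by blast

lemma ext_vanishE:
  assumes "ext_vanish C d i b" "f \<in> Hom C (Dom C (d i)) b"
    "f \<cdot>\<^bsub>C\<^esub> d (Suc i) = Zero C (Dom C (d (Suc i))) b"
  obtains g where "g \<in> Hom C (Cod C (d i)) b" "g \<cdot>\<^bsub>C\<^esub> d i = f"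
  using assms unfolding ext_vanish_def by blast

section \<open>Resolutions, and the exactness of Ext in its second argument on cocycles\<close>

context abelian_category
begin

lemma projective_lift:
  assumes "is_projective C p" "is_epi C e" "e \<in> Hom C b c" "f \<in> Hom C p c"
  obtains g where "g \<in> Hom C p b" "e \<cdot> g = f"
  using assms HomD(2,3)[OF assms(3)] unfolding is_projective_def by blast

lemma injective_extend:
  assumes "is_injective C q" "is_mono C m" "m \<in> Hom C a b" "f \<in> Hom C a q"
  obtains g where "g \<in> Hom C b q" "g \<cdot> m = f"
  using assms HomD(2,3)[OF assms(3)] unfolding is_injective_def by blast

lemma short_exactD:
  assumes "short_exact C f g"
  shows "f \<in> Hom C (Dom C f) (Dom C g)" "g \<in> Hom C (Dom C g) (Cod C g)"
    "g \<cdot> f = Zero C (Dom C f) (Cod C g)" "is_mono C f" "is_epi C g"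
    "is_kernel C f g" "is_cokernel C g f" "exact_at C f g"
  using assms exact_atD[of f g] exact_mono_kernel[of f g] exact_epi_cokernel[of f g]
  unfolding short_exact_def by blast+

lemma short_exact_kernel:
  assumes "is_kernel C k g" "is_epi C g" "g \<in> Hom C b c"
  shows "short_exact C k g"
  using assms kernelD(3)[OF assms(1,3)] exact_at_kernel[OF assms(1,3)]
  unfolding short_exact_def by blast

lemma resolutionD:
  assumes "projective_resolution C d a"
  shows "d 0 \<in> Hom C (Dom C (d 0)) a" "d i \<in> Hom C (Dom C (d i)) (Cod C (d i))"
    "d (Suc i) \<in> Hom C (Dom C (d (Suc i))) (Dom C (d i))" "Cod C (d (Suc i)) = Dom C (d i)"
    "d i \<cdot> d (Suc i) = Zero C (Dom C (d (Suc i))) (Cod C (d i))" "is_epi C (d 0)"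
    "is_projective C (Dom C (d i))" "exact_at C (d (Suc i)) (d i)" "Cod C (d 0) = a"
proof -
  have e: "exact_at C (d (Suc i)) (d i)" for i
    using assms unfolding projective_resolution_def by blast
  note ed = exact_atD[OF e]
  show "Cod C (d 0) = a" "is_epi C (d 0)" "is_projective C (Dom C (d i))"
    using assms unfolding projective_resolution_def by blast+
  then show "d 0 \<in> Hom C (Dom C (d 0)) a" using ed(2)[of 0] by simp
  show "d i \<in> Hom C (Dom C (d i)) (Cod C (d i))"
    "d (Suc i) \<in> Hom C (Dom C (d (Suc i))) (Dom C (d i))" "exact_at C (d (Suc i)) (d i)"
    "d i \<cdot> d (Suc i) = Zero C (Dom C (d (Suc i))) (Cod C (d i))"
    using ed e by blast+
  then show "Cod C (d (Suc i)) = Dom C (d i)" using HomD(3) by blast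
qed

text \<open>\<open>d 0\<close> is an epi in an exact sequence, hence a cokernel of
  \<open>d 1\<close>. This lets degree 0 of the long exact sequence be handled by the same lemmas as
  the higher degrees.\<close>

lemma ext_vanish_0:
  assumes "projective_resolution C d a"
  shows "ext_vanish C d 0 b"
proof (rule ext_vanishI)
  fix f
  assume f: "f \<in> Hom C (Dom C (d 0)) b" "f \<cdot> d (Suc 0) = Zero C (Dom C (d (Suc 0))) b"
  note r = resolutionD[OF assms]
  have "is_cokernel C (d 0) (d (Suc 0))" using exact_epi_cokernel r(6) r(8)[of 0] by blast
  then show "\<exists>g\<in>Hom C (Cod C (d 0)) b. g \<cdot> d 0 = f"
    using cokernel_extend[OF _ r(3) f] by blast
qed

text \<open>A cocycle factors through the image of \<open>d i\<close>; by injectivity it extends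
  along the inclusion \<open>m\<close> of this image.\<close>

lemma ext_vanish_injective:
  assumes "projective_resolution C d a" "is_injective C q"
  shows "ext_vanish C d i q"
proof (rule ext_vanishI)
  fix f
  assume f: "f \<in> Hom C (Dom C (d i)) q" "f \<cdot> d (Suc i) = Zero C (Dom C (d (Suc i))) q"
  note r = resolutionD[OF assms(1)]
  obtain e m where em: "is_cokernel C e (d (Suc i))" "is_epi C e" "is_mono C m"
    "e \<in> Hom C (Dom C (d i)) (Cod C e)" "m \<in> Hom C (Cod C e) (Cod C (d i))" "d i = m \<cdot> e"
    using exact_factor[OF r(8)] .
  obtain y where y: "y \<in> Hom C (Cod C e) q" "y \<cdot> e = f"
    using cokernel_extend[OF em(1) r(3) f] .
  obtain g where g: "g \<in> Hom C (Cod C (d i)) q" "g \<cdot> m = y"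
    using injective_extend[OF assms(2) em(3,5) y(1)] .
  have "g \<cdot> d i = f" using Comp_assoc[OF em(4,5) g(1)] em(6) g(2) y(2) by simp
  then show "\<exists>g\<in>Hom C (Cod C (d i)) q. g \<cdot> d i = f" using g(1) by blast
qed

text \<open>Push the cocycle along \<open>u\<close>, write it as a coboundary in \<open>s\<close>,
  and return along \<open>v\<close>.\<close>

lemma ext_vanish_retract:
  assumes "projective_resolution C d a" "ext_vanish C d i s"
    and u: "u \<in> Hom C c s" and v: "v \<in> Hom C s c" and vu: "v \<cdot> u = Id C c"
  shows "ext_vanish C d i c"
proof (rule ext_vanishI)
  fix f
  assume f: "f \<in> Hom C (Dom C (d i)) c" "f \<cdot> d (Suc i) = Zero C (Dom C (d (Suc i))) c"
  note r = resolutionD[OF assms(1)]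
  have "u \<cdot> f \<cdot> d (Suc i) = Zero C (Dom C (d (Suc i))) s"
    using Comp_assoc[OF r(3) f(1) u] f(2) Comp_Zero[OF u HomD(4)[OF r(3)]] by simp
  then obtain g where g: "g \<in> Hom C (Cod C (d i)) s" "g \<cdot> d i = u \<cdot> f"
    using ext_vanishE[OF assms(2) Comp_in[OF f(1) u]] by blast
  have "v \<cdot> g \<cdot> d i = v \<cdot> u \<cdot> f"
    using Comp_assoc[OF r(2) g(1) v] g(2) Comp_assoc[OF f(1) u v] by simp
  then have "v \<cdot> g \<cdot> d i = f" using vu Id_Comp[OF f(1)] by simp
  then show "\<exists>g\<in>Hom C (Cod C (d i)) c. g \<cdot> d i = f" using Comp_in[OF g(1) v] by blast
qed

text \<open>Exactness of Ext at the quotient term, by a diagram chase. The result \<open>l\<close>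
  stays in the middle object instead of being composed with \<open>g\<close>, because degree 0 is
  used later to lift arrows along \<open>g\<close>.\<close>

lemma connecting_lift:
  assumes "projective_resolution C d a" "short_exact C f g"
    and vM: "ext_vanish C d i (Dom C g)" and vM': "ext_vanish C d (Suc i) (Dom C f)"
    and x: "x \<in> Hom C (Dom C (d i)) (Cod C g)" "x \<cdot> d (Suc i) = Zero C (Dom C (d (Suc i))) (Cod C g)"
  obtains l where "l \<in> Hom C (Cod C (d i)) (Dom C g)" "g \<cdot> l \<cdot> d i = x"
proof -
  note r = resolutionD[OF assms(1)]
  note s = short_exactD[OF assms(2)]
  let ?P = "\<lambda>i. Dom C (d i)"
  obtain x' where x': "x' \<in> Hom C (?P i) (Dom C g)" "g \<cdot> x' = x"
    using projective_lift[OF r(7) s(5,2) x(1)] .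
  have "g \<cdot> (x' \<cdot> d (Suc i)) = Zero C (?P (Suc i)) (Cod C g)"
    using Comp_assoc[OF r(3) x'(1) s(2)] x'(2) x(2) by simp
  \<comment> \<open>\<open>h\<close> represents the image of \<open>x\<close> under the connecting
    homomorphism. It is a cocycle because \<open>f\<close> is mono.\<close>
  then obtain h where h: "h \<in> Hom C (?P (Suc i)) (Dom C f)" "f \<cdot> h = x' \<cdot> d (Suc i)"
    using kernel_lift[OF s(6,2) Comp_in[OF r(3) x'(1)]] by blast
  have dd: "d (Suc i) \<cdot> d (Suc (Suc i)) = Zero C (?P (Suc (Suc i))) (?P i)"
    using r(5)[of "Suc i"] r(4)[of i] by simp
  have o: "?P (Suc (Suc i)) \<in> Obj C" "Dom C f \<in> Obj C"
    using HomD(4)[OF r(3)] HomD(4)[OF s(1)] by auto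
  have "f \<cdot> (h \<cdot> d (Suc (Suc i))) = x' \<cdot> (d (Suc i) \<cdot> d (Suc (Suc i)))"
    using Comp_assoc[OF r(3) h(1) s(1)] h(2) Comp_assoc[OF r(3) r(3) x'(1)] by simp
  also have "\<dots> = f \<cdot> Zero C (?P (Suc (Suc i))) (Dom C f)"
    using dd Comp_Zero[OF x'(1) o(1)] Comp_Zero[OF s(1) o(1)] by simp
  finally have "h \<cdot> d (Suc (Suc i)) = Zero C (?P (Suc (Suc i))) (Dom C f)"
    using mono_cancel[OF s(4,1) Comp_in[OF r(3) h(1)] Zero_in[OF o]] by blast
  then obtain k where k: "k \<in> Hom C (Cod C (d (Suc i))) (Dom C f)" "k \<cdot> d (Suc i) = h"
    using ext_vanishE[OF vM' h(1)] by blast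
  have k1: "k \<in> Hom C (?P i) (Dom C f)" using k(1) r(4) by simp
  note fk = Comp_in[OF k1 s(1)]
  \<comment> \<open>Since \<open>h\<close> is the coboundary of \<open>k\<close>, correcting the
    lift \<open>x'\<close> by \<open>f \<cdot> k\<close> yields a cocycle \<open>t\<close>, still
    lying over \<open>x\<close>.\<close>
  obtain t where t: "t \<in> Hom C (?P i) (Dom C g)" "x' = Plus C t (f \<cdot> k)"
    using subtract[OF x'(1) fk] .
  have "Plus C (t \<cdot> d (Suc i)) (f \<cdot> k \<cdot> d (Suc i)) = f \<cdot> k \<cdot> d (Suc i)"
    using Comp_Plus[OF r(3) t(1) fk] t(2) h(2) k(2) Comp_assoc[OF r(3) k1 s(1)] by simp
  then have "t \<cdot> d (Suc i) = Zero C (?P (Suc i)) (Dom C g)"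
    using Plus_eq_right[OF Comp_in[OF r(3) t(1)] Comp_in[OF r(3) fk]] by blast
  then obtain l where l: "l \<in> Hom C (Cod C (d i)) (Dom C g)" "l \<cdot> d i = t"
    using ext_vanishE[OF vM t(1)] by blast
  have "g \<cdot> (f \<cdot> k) = Zero C (?P i) (Cod C g)"
    using Comp_assoc[OF k1 s(1,2)] s(3) Zero_Comp[OF k1 HomD(5)[OF s(2)]] by simp
  then have "x = g \<cdot> t"
    using x'(2) t(2) Plus_Comp[OF t(1) fk s(2)] Plus_Zero(1)[OF Comp_in[OF t(1) s(2)]] by simp
  then have "g \<cdot> l \<cdot> d i = x" using l(2) Comp_assoc[OF r(2) l(1) s(2)] by simp
  then show thesis using that l(1) by blast
qed

lemma ext_vanish_quotient:
  assumes "projective_resolution C d a" "short_exact C f g"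
    and "ext_vanish C d i (Dom C g)" "ext_vanish C d (Suc i) (Dom C f)"
  shows "ext_vanish C d i (Cod C g)"
proof (rule ext_vanishI)
  fix x
  assume x: "x \<in> Hom C (Dom C (d i)) (Cod C g)"
    "x \<cdot> d (Suc i) = Zero C (Dom C (d (Suc i))) (Cod C g)"
  obtain l where l: "l \<in> Hom C (Cod C (d i)) (Dom C g)" "g \<cdot> l \<cdot> d i = x"
    using connecting_lift[OF assms x] .
  then show "\<exists>l\<in>Hom C (Cod C (d i)) (Cod C g). l \<cdot> d i = x"
    using Comp_in[OF l(1) short_exactD(2)[OF assms(2)]] by blast
qed

text \<open>Degree 0 of \<open>connecting_lift\<close>, applied to the cocycle
  \<open>x \<cdot> d 0\<close>; the epi \<open>d 0\<close> is cancelled at the end.\<close>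

lemma ext_vanish_lift:
  assumes "projective_resolution C d a" "short_exact C f g" "ext_vanish C d 1 (Dom C f)"
    and x: "x \<in> Hom C a (Cod C g)"
  obtains y where "y \<in> Hom C a (Dom C g)" "g \<cdot> y = x"
proof -
  note r = resolutionD[OF assms(1)]
  note s = short_exactD[OF assms(2)]
  have "x \<cdot> d 0 \<cdot> d (Suc 0) = Zero C (Dom C (d (Suc 0))) (Cod C g)"
    using Comp_assoc[OF r(3) r(1) x] r(5)[of 0] r(9) Comp_Zero[OF x HomD(4)[OF r(3)]] by simp
  then obtain l where l: "l \<in> Hom C (Cod C (d 0)) (Dom C g)" "g \<cdot> l \<cdot> d 0 = x \<cdot> d 0"
    using connecting_lift[OF assms(1,2) ext_vanish_0[OF assms(1)] assms(3)[unfolded One_nat_def]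
        Comp_in[OF r(1) x]] by blast
  have l1: "l \<in> Hom C a (Dom C g)" using l(1) r(9) by simp
  show thesis using that[OF l1] epi_cancel[OF r(6,1) Comp_in[OF l1 s(2)] x l(2)] by blast
qed

text \<open>Exactness of Ext at the sub-object, in degree \<open>Suc i\<close>. The lifting
  hypothesis covers two situations: for \<open>i = 0\<close> the arrows start at the resolved
  object, for positive \<open>i\<close> at a projective.\<close>

lemma ext_vanish_sub:
  assumes "projective_resolution C d a" "short_exact C f g"
    and vM: "ext_vanish C d (Suc i) (Dom C g)" and vM'': "ext_vanish C d i (Cod C g)"
    and lift: "\<And>x. x \<in> Hom C (Cod C (d i)) (Cod C g) \<Longrightarrow>
      \<exists>y \<in> Hom C (Cod C (d i)) (Dom C g). g \<cdot> y = x"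
  shows "ext_vanish C d (Suc i) (Dom C f)"
proof (rule ext_vanishI)
  let ?P = "\<lambda>i. Dom C (d i)"
  fix h
  assume h: "h \<in> Hom C (?P (Suc i)) (Dom C f)"
    "h \<cdot> d (Suc (Suc i)) = Zero C (?P (Suc (Suc i))) (Dom C f)"
  note r = resolutionD[OF assms(1)]
  note s = short_exactD[OF assms(2)]
  have "f \<cdot> h \<cdot> d (Suc (Suc i)) = Zero C (?P (Suc (Suc i))) (Dom C g)"
    using Comp_assoc[OF r(3) h(1) s(1)] h(2) Comp_Zero[OF s(1) HomD(4)[OF r(3)]] by simp
  then obtain k where "k \<in> Hom C (Cod C (d (Suc i))) (Dom C g)" and kd: "k \<cdot> d (Suc i) = f \<cdot> h"
    using ext_vanishE[OF vM Comp_in[OF h(1) s(1)]] by blast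
  then have k: "k \<in> Hom C (?P i) (Dom C g)" using r(4) by simp
  have "g \<cdot> k \<cdot> d (Suc i) = g \<cdot> f \<cdot> h"
    using Comp_assoc[OF r(3) k s(2)] kd Comp_assoc[OF h(1) s(1,2)] by simp
  also have "\<dots> = Zero C (?P (Suc i)) (Cod C g)"
    using s(3) Zero_Comp[OF h(1) HomD(5)[OF s(2)]] by simp
  finally obtain l where l: "l \<in> Hom C (Cod C (d i)) (Cod C g)" "l \<cdot> d i = g \<cdot> k"
    using ext_vanishE[OF vM'' Comp_in[OF k s(2)]] by blast
  obtain l' where l': "l' \<in> Hom C (Cod C (d i)) (Dom C g)" "g \<cdot> l' = l"
    using lift[OF l(1)] by blast
  note l'd = Comp_in[OF r(2) l'(1)]
  \<comment> \<open>Subtracting \<open>l' \<cdot> d i\<close> leaves the coboundary of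
    \<open>k\<close> unchanged and makes the difference vanish under \<open>g\<close>, so that it
    comes from the sub-object.\<close>
  obtain t where t: "t \<in> Hom C (?P i) (Dom C g)" "k = Plus C t (l' \<cdot> d i)"
    using subtract[OF k l'd] .
  have "Plus C (g \<cdot> t) (g \<cdot> (l' \<cdot> d i)) = g \<cdot> (l' \<cdot> d i)"
    using Plus_Comp[OF t(1) l'd s(2)] t(2) l(2) l'(2) Comp_assoc[OF r(2) l'(1) s(2)] by simp
  then have "g \<cdot> t = Zero C (?P i) (Cod C g)"
    using Plus_eq_right[OF Comp_in[OF t(1) s(2)] Comp_in[OF l'd s(2)]] by blast
  then obtain w where w: "w \<in> Hom C (?P i) (Dom C f)" "f \<cdot> w = t"
    using kernel_lift[OF s(6,2) t(1)] by blast
  have "l' \<cdot> d i \<cdot> d (Suc i) = Zero C (?P (Suc i)) (Dom C g)"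
    using Comp_assoc[OF r(3) r(2) l'(1)] r(5) Comp_Zero[OF l'(1) HomD(4)[OF r(3)]] by simp
  then have "k \<cdot> d (Suc i) = t \<cdot> d (Suc i)"
    using t(2) Comp_Plus[OF r(3) t(1) l'd] Plus_Zero(1)[OF Comp_in[OF r(3) t(1)]] by simp
  then have "f \<cdot> (w \<cdot> d (Suc i)) = f \<cdot> h"
    using kd w(2) Comp_assoc[OF r(3) w(1) s(1)] by simp
  then have "w \<cdot> d (Suc i) = h"
    using mono_cancel[OF s(4,1) Comp_in[OF r(3) w(1)] h(1)] by blast
  then show "\<exists>g\<in>Hom C (Cod C (d (Suc i))) (Dom C f). g \<cdot> d (Suc i) = h"
    using w(1) r(4) by auto
qed

text \<open>The codomain of \<open>d (Suc i)\<close> is a term of the resolution, so its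
  projectivity provides the lifts.\<close>

lemma ext_vanish_sub_Suc:
  assumes "projective_resolution C d a" "short_exact C f g"
    and "ext_vanish C d (Suc (Suc i)) (Dom C g)" "ext_vanish C d (Suc i) (Cod C g)"
  shows "ext_vanish C d (Suc (Suc i)) (Dom C f)"
proof (rule ext_vanish_sub[OF assms])
  note r = resolutionD[OF assms(1)]
  note s = short_exactD[OF assms(2)]
  fix x assume "x \<in> Hom C (Cod C (d (Suc i))) (Cod C g)"
  then show "\<exists>y\<in>Hom C (Cod C (d (Suc i))) (Dom C g). g \<cdot> y = x"
    using projective_lift[OF r(7)[of i] s(5,2)] r(4)[of i] by metis
qed

lemma ext_vanish_sub_1:
  assumes "projective_resolution C d a" "short_exact C f g"
    and "ext_vanish C d 1 (Dom C g)"
    and "\<And>x. x \<in> Hom C a (Cod C g) \<Longrightarrow> \<exists>y \<in> Hom C a (Dom C g). g \<cdot> y = x"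
  shows "ext_vanish C d 1 (Dom C f)"
  using ext_vanish_sub[OF assms(1,2) assms(3)[unfolded One_nat_def] ext_vanish_0[OF assms(1)]]
    assms(4) resolutionD(9)[OF assms(1)] by simp

end

section \<open>Balancing Ext\<close>

context abelian_category
begin

lemma coresolutionD:
  assumes "projective_resolution (op_cat C) e b"
  shows "e 0 \<in> Hom C b (Cod C (e 0))" "e i \<in> Hom C (Dom C (e i)) (Cod C (e i))"
    "e (Suc i) \<in> Hom C (Cod C (e i)) (Cod C (e (Suc i)))" "Dom C (e (Suc i)) = Cod C (e i)"
    "e (Suc i) \<cdot> e i = Zero C (Dom C (e i)) (Cod C (e (Suc i)))" "is_mono C (e 0)"
    "is_injective C (Cod C (e i))" "exact_at C (e i) (e (Suc i))" "Dom C (e 0) = b"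
  using abelian_category.resolutionD[OF abelian_op assms] by simp_all

text \<open>The cosyzygy of \<open>b\<close> is the image of \<open>e 1\<close>; dropping \<open>e 0\<close> gives a coresolution of it.\<close>

lemma cosyzygy:
  assumes "projective_resolution (op_cat C) e b"
  obtains q m where "short_exact C (e 0) q" "e 1 = m \<cdot> q" "is_mono C m"
    "q \<in> Hom C (Dom C (e 1)) (Cod C q)" "m \<in> Hom C (Cod C q) (Cod C (e 1))"
    "is_kernel C m (e 2)"
    "projective_resolution (op_cat C) (case_nat m (\<lambda>j. e (Suc (Suc j)))) (Cod C q)"
proof -
  note r = coresolutionD[OF assms]
  obtain q m where qm: "is_cokernel C q (e 0)" "is_epi C q" "is_mono C m"
    "q \<in> Hom C (Dom C (e (Suc 0))) (Cod C q)" "m \<in> Hom C (Cod C q) (Cod C (e (Suc 0)))"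
    "e (Suc 0) = m \<cdot> q"
    using exact_factor[OF r(8)[of 0]] .
  have ses: "short_exact C (e 0) q"
    using abelian_category.short_exact_kernel[OF abelian_op, of q "e 0"] qm(1) r(6) r(1) by simp
  have ex: "exact_at C m (e (Suc (Suc 0)))"
    using r(8)[of "Suc 0"] exact_at_comp_epi[OF qm(2,4,5)] qm(6) by simp
  have "exact_at C (case_nat m (\<lambda>j. e (Suc (Suc j))) i) (e (Suc (Suc i)))" for i
    using ex r(8) by (cases i) auto
  moreover have "is_injective C (Cod C (case_nat m (\<lambda>j. e (Suc (Suc j))) i))" for i
    using HomD(3)[OF qm(5)] r(7) by (cases i) auto
  ultimately have "projective_resolution (op_cat C) (case_nat m (\<lambda>j. e (Suc (Suc j)))) (Cod C q)"
    unfolding projective_resolution_def using qm(3) HomD(2)[OF qm(5)] by simp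
  then show thesis
    using that[OF ses _ qm(3)] qm exact_mono_kernel[OF ex qm(3)]
    by (simp add: numeral_2_eq_2)
qed

text \<open>Both sides say that every arrow from \<open>a\<close> to the cosyzygy
  \<open>Cod C q\<close> lifts along \<open>q\<close>. On the right this is because \<open>m\<close>
  identifies the cosyzygy with the kernel of \<open>e 2\<close>.\<close>

lemma ext_vanish_balance_1:
  assumes d: "projective_resolution C d a" and e: "projective_resolution (op_cat C) e b"
  shows "ext_vanish C d 1 b \<longleftrightarrow> ext_vanish (op_cat C) e 1 a"
proof -
  note r = coresolutionD[OF e]
  obtain q m where ses: "short_exact C (e 0) q" and e1: "e 1 = m \<cdot> q" and m: "is_mono C m"
    and qh: "q \<in> Hom C (Dom C (e 1)) (Cod C q)" and mh: "m \<in> Hom C (Cod C q) (Cod C (e 1))"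
    and ker: "is_kernel C m (e 2)"
    using cosyzygy[OF e] by blast
  have e2: "e 2 \<in> Hom C (Cod C (e 1)) (Cod C (e 2))" using r(3)[of 1] by (simp add: numeral_2_eq_2)
  note Dm = HomD(2)[OF mh] and Dq = HomD(2)[OF qh]
  show ?thesis
  proof
    assume v: "ext_vanish C d 1 b"
    show "ext_vanish (op_cat C) e 1 a"
    proof (rule ext_vanishI, unfold op_cat_simps Hom_op One_nat_def[symmetric] Suc_1)
      fix f
      assume f: "f \<in> Hom C a (Cod C (e 1))" "e 2 \<cdot> f = Zero C a (Cod C (e 2))"
      obtain f' where f': "f' \<in> Hom C a (Cod C q)" "m \<cdot> f' = f"
        using kernel_lift[OF ker e2 f] Dm by metis
      obtain y where y: "y \<in> Hom C a (Dom C q)" "q \<cdot> y = f'"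
        using ext_vanish_lift[OF d ses _ f'(1)] v r(9) by blast
      have "e 1 \<cdot> y = f" using Comp_assoc[OF y(1)[unfolded Dq] qh mh] y(2) f'(2) e1 by simp
      then show "\<exists>g\<in>Hom C a (Dom C (e 1)). e 1 \<cdot> g = f" using y(1) Dq by auto
    qed
  next
    assume v: "ext_vanish (op_cat C) e 1 a"
    \<comment> \<open>\<open>b\<close> is the first term of \<open>ses\<close> and the middle term
      is injective, so vanishing reduces to lifting arrows along \<open>q\<close>.\<close>
    have "ext_vanish C d 1 (Dom C (e 0))"
    proof (rule ext_vanish_sub_1[OF d ses])
      show "ext_vanish C d 1 (Dom C q)"
        using ext_vanish_injective[OF d r(7)[of 0]] r(4)[of 0] Dq by simp
    next
      fix x assume x: "x \<in> Hom C a (Cod C q)"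
      note mx = Comp_in[OF x mh]
      have "e 2 \<cdot> (m \<cdot> x) = Zero C a (Cod C (e 2))"
        using Comp_assoc[OF x mh e2] kernelD(2)[OF ker e2] Dm Zero_Comp[OF x HomD(5)[OF e2]] by simp
      then obtain g where g: "g \<in> Hom C a (Dom C (e 1))" "e 1 \<cdot> g = m \<cdot> x"
        using ext_vanishE[OF v, of "m \<cdot> x"] mx
        unfolding op_cat_simps Hom_op One_nat_def[symmetric] Suc_1 by blast
      have "m \<cdot> (q \<cdot> g) = m \<cdot> x" using Comp_assoc[OF g(1) qh mh] g(2) e1 by simp
      then have "q \<cdot> g = x" using mono_cancel[OF m mh Comp_in[OF g(1) qh] x] by blast
      then show "\<exists>y\<in>Hom C a (Dom C q). q \<cdot> y = x" using g(1) Dq by auto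
    qed
    then show "ext_vanish C d 1 b" using r(9) by simp
  qed
qed

text \<open>Induction on the degree. Replacing \<open>b\<close> by its cosyzygy lowers the degree by
  one on both sides: on the left by dimension shifting over an injective, on the right by shortening
  the coresolution.\<close>

lemma ext_vanish_balance:
  assumes d: "projective_resolution C d a" and "projective_resolution (op_cat C) e b"
  shows "ext_vanish C d (Suc i) b \<longleftrightarrow> ext_vanish (op_cat C) e (Suc i) a"
  using assms(2)
proof (induction i arbitrary: e b)
  case 0
  then show ?case using ext_vanish_balance_1[OF d] by simp
next
  case (Suc i)
  note r = coresolutionD[OF Suc.prems]
  obtain q m where ses: "short_exact C (e 0) q" and qh: "q \<in> Hom C (Dom C (e 1)) (Cod C q)"
    and e': "projective_resolution (op_cat C) (case_nat m (\<lambda>j. e (Suc (Suc j)))) (Cod C q)"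
    using cosyzygy[OF Suc.prems] by blast
  have v: "ext_vanish C d j (Dom C q)" for j
    using ext_vanish_injective[OF d r(7)[of 0]] r(4)[of 0] HomD(2)[OF qh] by simp
  have "ext_vanish C d (Suc (Suc i)) b \<longleftrightarrow> ext_vanish C d (Suc i) (Cod C q)"
    using ext_vanish_quotient[OF d ses v] ext_vanish_sub_Suc[OF d ses v] r(9) by metis
  also have "\<dots> \<longleftrightarrow> ext_vanish (op_cat C) (case_nat m (\<lambda>j. e (Suc (Suc j)))) (Suc i) a"
    by (rule Suc.IH[OF e'])
  \<comment> \<open>In positive degree the new first arrow \<open>m\<close> does not enter the
    definition; all other entries are those of \<open>e\<close>, shifted by one.\<close>
  also have "\<dots> \<longleftrightarrow> ext_vanish (op_cat C) e (Suc (Suc i)) a"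
    by (simp add: ext_vanish_def)
  finally show ?case .
qed

text \<open>Each next differential is a kernel of the previous one, preceded by an epi from a
  projective; such an epi does not affect exactness.\<close>

lemma ex_projective_resolution:
  assumes "enough_projectives C" "a \<in> Obj C"
  obtains d where "projective_resolution C d a"
proof -
  let ?P = "\<lambda>n f. f \<in> Arr C \<and> is_projective C (Dom C f) \<and> (n = (0::nat) \<longrightarrow> Cod C f = a \<and> is_epi C f)"
  have cover: "\<exists>e. e \<in> Hom C (Dom C e) b \<and> is_projective C (Dom C e) \<and> is_epi C e" if "b \<in> Obj C" for b
    using assms(1) that HomD(2) unfolding enough_projectives_def by metis
  have "\<exists>d. \<forall>n. ?P n (d n) \<and> exact_at C (d (Suc n)) (d n)"
  proof (rule dependent_nat_choice)
    obtain e where "e \<in> Hom C (Dom C e) a" "is_projective C (Dom C e)" "is_epi C e"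
      using cover[OF assms(2)] by blast
    then show "\<exists>f. ?P 0 f" using HomD(1,3) by blast
  next
    fix f n
    assume P: "?P n f"
    then have f: "f \<in> Hom C (Dom C f) (Cod C f)" using HomI by blast
    obtain k where k: "is_kernel C k f" using ex_kernel P by blast
    note kD = kernelD[OF k f]
    obtain e where e: "e \<in> Hom C (Dom C e) (Dom C k)" "is_projective C (Dom C e)" "is_epi C e"
      using cover[OF HomD(4)[OF kD(1)]] by blast
    have "exact_at C (k \<cdot> e) f"
      using exact_at_comp_epi[OF e(3,1) kD(1)] exact_at_kernel[OF k f] by blast
    moreover have "k \<cdot> e \<in> Arr C" "Dom C (k \<cdot> e) = Dom C e" 
      using HomD[OF Comp_in[OF e(1) kD(1)]] by auto
    ultimately show "\<exists>f'. ?P (Suc n) f' \<and> exact_at C f' f" using e(2) by auto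
  qed
  then show thesis using that unfolding projective_resolution_def by blast
qed

lemma trivial_ext_via:
  assumes "projective_resolution C d a" "b \<in> Obj C"
  shows "trivial_group (ext_via C d (Suc j) b) \<longleftrightarrow> ext_vanish C d (Suc j) b"
proof -
  note r = resolutionD[OF assms(1)]
  let ?G = "\<lambda>i. hom_group C (Dom C (d i)) b"
  let ?h = "\<lambda>i f. f \<cdot> d (Suc i)"
  have G: "comm_group (?G i)" for i
    using hom_comm_group HomD(4)[OF r(2)] assms(2) by blast
  have h: "group_hom (?G i) (?G (Suc i)) (?h i)" for i
  proof (intro group_hom.intro group_hom_axioms.intro comm_group.axioms(2)[OF G] homI)
    show "?h i f \<in> carrier (?G (Suc i))" if "f \<in> carrier (?G i)" for f
      using that Comp_in[OF r(3)] by (simp add: hom_group_def)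
    show "?h i (f \<otimes>\<^bsub>?G i\<^esub> g) = ?h i f \<otimes>\<^bsub>?G (Suc i)\<^esub> ?h i g"
      if "f \<in> carrier (?G i)" "g \<in> carrier (?G i)" for f g
      using that Comp_Plus[OF r(3)] by (simp add: hom_group_def)
  qed
  define Z where "Z = ext_cocycles C d (Suc j) b"
  define B where "B = ext_coboundaries C d (Suc j) b"
  interpret G: comm_group "?G (Suc j)" by (rule G)
  have Z: "Z = kernel (?G (Suc j)) (?G (Suc (Suc j))) (?h (Suc j))"
    by (simp add: Z_def ext_cocycles_def)
  have B: "B = ?h j ` carrier (?G j)" by (simp add: B_def ext_coboundaries_def hom_group_def)
  have sZ: "subgroup Z (?G (Suc j))" unfolding Z using group_hom.subgroup_kernel[OF h] .
  have sB: "subgroup B (?G (Suc j))" unfolding B using group_hom.img_is_subgroup[OF h] .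
  have BZ: "B \<subseteq> Z"
  proof
    fix x assume "x \<in> B"
    then obtain f where f: "f \<in> Hom C (Dom C (d j)) b" "x = f \<cdot> d (Suc j)"
      unfolding B by (auto simp: hom_group_def)
    have "f \<cdot> d (Suc j) \<cdot> d (Suc (Suc j)) = Zero C (Dom C (d (Suc (Suc j)))) b"
      using Comp_assoc[OF r(3) r(3) f(1)] r(5)[of "Suc j"] r(4)[of j]
        Comp_Zero[OF f(1) HomD(4)[OF r(3)]] by simp
    then show "x \<in> Z" unfolding Z kernel_def using f Comp_in[OF r(3) f(1)]
      by (simp add: hom_group_def)
  qed
  let ?Z = "(?G (Suc j))\<lparr>carrier := Z\<rparr>"
  interpret Z: comm_group ?Z
    using group.group_comm_groupI[OF subgroup.subgroup_is_group[OF sZ G.is_group]] G.m_comm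
      subgroup.mem_carrier[OF sZ] by simp
  have sBZ: "subgroup B ?Z" using G.subgroup_incl[OF sB sZ BZ] .
  then interpret B: normal B ?Z using Z.normal_iff_subgroup by blast
  \<comment> \<open>Triviality means that every coset equals the neutral one \<open>B\<close>, and
    the coset of \<open>x\<close> is \<open>B\<close> just when \<open>x\<close> lies in
    \<open>B\<close>.\<close>
  have "trivial_group (?Z Mod B) \<longleftrightarrow> (\<lambda>x. B #>\<^bsub>?Z\<^esub> x) ` Z \<subseteq> {B}"
    using group.trivial_group_subset[OF B.factorgroup_is_group]
    by (simp add: carrier_FactGroup)
  also have "\<dots> \<longleftrightarrow> (\<forall>x\<in>Z. B #>\<^bsub>?Z\<^esub> x = B)" by blast
  also have "\<dots> \<longleftrightarrow> Z \<subseteq> B"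
    using Z.coset_join1[OF _ _ sBZ] Z.coset_join2[OF _ sBZ] B.subset by auto
  also have "\<dots> \<longleftrightarrow> ext_vanish C d (Suc j) b"
    unfolding Z B kernel_def ext_vanish_def r(4) by (auto simp: hom_group_def image_iff)
  finally show ?thesis unfolding ext_via_def Z_def B_def .
qed

end

section \<open>Vanishing of the groups \<open>Ext\<close>: independence of the resolution, symmetry,
  exactness\<close>

locale abelian_category_enough = abelian_category +
  assumes enough_proj: "enough_projectives C" and enough_inj: "enough_injectives C"
begin

lemma enough_op: "abelian_category_enough (op_cat C)"
  by (intro abelian_category_enough.intro abelian_category_enough_axioms.intro abelian_op)
    (simp_all add: enough_proj enough_inj)

lemma ex_resolution:
  assumes "a \<in> Obj C"
  obtains d where "projective_resolution C d a"
  using ex_projective_resolution[OF enough_proj assms] .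

lemma Ext_trivial_SOME:
  assumes "a \<in> Obj C" "b \<in> Obj C"
  shows "trivial_group (Ext C (Suc i) a b) \<longleftrightarrow>
    ext_vanish C (SOME d. projective_resolution C d a) (Suc i) b"
  unfolding Ext_def
  using trivial_ext_via[OF _ assms(2)] ex_resolution[OF assms(1)] someI_ex by metis

text \<open>The given resolution and the one chosen in \<open>Ext\<close> are compared through a
  single injective coresolution of \<open>b\<close>.\<close>

lemma Ext_trivial_iff:
  assumes d: "projective_resolution C d a" and b: "b \<in> Obj C"
  shows "trivial_group (Ext C (Suc i) a b) \<longleftrightarrow> ext_vanish C d (Suc i) b"
proof -
  have a: "a \<in> Obj C" using HomD(5)[OF resolutionD(1)[OF d]] .
  obtain e where e: "projective_resolution (op_cat C) e b"
    using abelian_category_enough.ex_resolution[OF enough_op, of b] b by auto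
  have "projective_resolution C (SOME d. projective_resolution C d a) a"
    using someI[of "\<lambda>d. projective_resolution C d a", OF d] .
  then show ?thesis
    using ext_vanish_balance[OF _ e] d Ext_trivial_SOME[OF a b] by simp
qed

lemma Ext_trivial_op:
  assumes "a \<in> Obj C" "b \<in> Obj C"
  shows "trivial_group (Ext (op_cat C) (Suc i) b a) \<longleftrightarrow> trivial_group (Ext C (Suc i) a b)"
proof -
  obtain d where d: "projective_resolution C d a" using ex_resolution[OF assms(1)] .
  obtain e where e: "projective_resolution (op_cat C) e b"
    using abelian_category_enough.ex_resolution[OF enough_op, of b] assms(2) by auto
  show ?thesis
    using Ext_trivial_iff[OF d assms(2)] abelian_category_enough.Ext_trivial_iff[OF enough_op e, of a]
      ext_vanish_balance[OF d e] assms(1) by simp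
qed

lemma left_perp_op:
  assumes "X \<subseteq> Obj C"
  shows "left_perp (op_cat C) (Suc i) X = right_perp C (Suc i) X"
    and "right_perp (op_cat C) (Suc i) X = left_perp C (Suc i) X"
  using assms by (auto simp: left_perp_def right_perp_def Ext_trivial_op subset_iff)

lemma Ext_injective:
  assumes "a \<in> Obj C" "is_injective C q"
  shows "trivial_group (Ext C (Suc i) a q)"
proof -
  obtain d where d: "projective_resolution C d a" using ex_resolution[OF assms(1)] .
  have "q \<in> Obj C" using assms(2) unfolding is_injective_def by blast
  then show ?thesis using Ext_trivial_iff[OF d] ext_vanish_injective[OF d assms(2)] by blast
qed

text \<open>A projective is injective in \<open>op_cat C\<close>, and the symmetry of Ext carries
  the vanishing over.\<close>

lemma Ext_projective:
  assumes "is_projective C p" "b \<in> Obj C"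
  shows "trivial_group (Ext C (Suc i) p b)"
proof -
  have "p \<in> Obj C" using assms(1) unfolding is_projective_def by blast
  then show ?thesis
    using abelian_category_enough.Ext_injective[OF enough_op, of b p] assms Ext_trivial_op by simp
qed

lemma Ext_retract:
  assumes "a \<in> Obj C" "trivial_group (Ext C (Suc i) a s)"
    and u: "u \<in> Hom C c s" and v: "v \<in> Hom C s c" and "v \<cdot> u = Id C c"
  shows "trivial_group (Ext C (Suc i) a c)"
proof -
  obtain d where d: "projective_resolution C d a" using ex_resolution[OF assms(1)] .
  show ?thesis
    using ext_vanish_retract[OF d _ u v assms(5)] assms(2)
      Ext_trivial_iff[OF d HomD(4)[OF u]] Ext_trivial_iff[OF d HomD(5)[OF u]] by blast
qed

lemma Ext_quotient:
  assumes "a \<in> Obj C" and s: "short_exact C f g"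
    and "trivial_group (Ext C (Suc i) a (Dom C g))" "trivial_group (Ext C (Suc (Suc i)) a (Dom C f))"
  shows "trivial_group (Ext C (Suc i) a (Cod C g))"
proof -
  obtain d where d: "projective_resolution C d a" using ex_resolution[OF assms(1)] .
  note sD = short_exactD[OF s]
  show ?thesis
    using ext_vanish_quotient[OF d s] assms(3,4) Ext_trivial_iff[OF d] HomD(4,5)[OF sD(1)]
      HomD(5)[OF sD(2)] by blast
qed

lemma Ext_lift:
  assumes "a \<in> Obj C" and s: "short_exact C f g"
    and "trivial_group (Ext C 1 a (Dom C f))" "x \<in> Hom C a (Cod C g)"
  obtains y where "y \<in> Hom C a (Dom C g)" "g \<cdot> y = x"
proof -
  obtain d where d: "projective_resolution C d a" using ex_resolution[OF assms(1)] .
  have "ext_vanish C d 1 (Dom C f)"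
    using assms(3) Ext_trivial_iff[OF d HomD(4)[OF short_exactD(1)[OF s]]] by simp
  then show thesis using ext_vanish_lift[OF d s _ assms(4)] that by blast
qed

lemma Ext_sub_Suc:
  assumes "a \<in> Obj C" and s: "short_exact C f g"
    and "trivial_group (Ext C (Suc (Suc i)) a (Dom C g))" "trivial_group (Ext C (Suc i) a (Cod C g))"
  shows "trivial_group (Ext C (Suc (Suc i)) a (Dom C f))"
proof -
  obtain d where d: "projective_resolution C d a" using ex_resolution[OF assms(1)] .
  note sD = short_exactD[OF s]
  show ?thesis
    using ext_vanish_sub_Suc[OF d s] assms(3,4) Ext_trivial_iff[OF d] HomD(4,5)[OF sD(1)]
      HomD(5)[OF sD(2)] by blast
qed

lemma Ext_sub_1:
  assumes "a \<in> Obj C" and s: "short_exact C f g"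
    and "trivial_group (Ext C 1 a (Dom C g))"
    and "\<And>x. x \<in> Hom C a (Cod C g) \<Longrightarrow> \<exists>y \<in> Hom C a (Dom C g). g \<cdot> y = x"
  shows "trivial_group (Ext C 1 a (Dom C f))"
proof -
  obtain d where d: "projective_resolution C d a" using ex_resolution[OF assms(1)] .
  have "ext_vanish C d 1 (Dom C g)"
    using assms(3) Ext_trivial_iff[OF d HomD(4)[OF short_exactD(2)[OF s]]] by simp
  then have "ext_vanish C d 1 (Dom C f)" using ext_vanish_sub_1[OF d s _ assms(4)] by blast
  then show ?thesis using Ext_trivial_iff[OF d HomD(4)[OF short_exactD(1)[OF s]]] by simp
qed

end

section \<open>Finite resolutions\<close>

context abelian_category
begin

text \<open>A mono is a kernel of some \<open>h\<close>. As \<open>f\<close> is also epi,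
  \<open>h\<close> is zero, so the identity of \<open>b\<close> lifts through
  \<open>f\<close>.\<close>

lemma iso_of_mono_epi:
  assumes "is_mono C f" "is_epi C f" "f \<in> Hom C a b"
  obtains g where "g \<in> Hom C b a" "f \<cdot> g = Id C b"
proof -
  obtain h where h: "is_kernel C f h" using mono_is_kernel assms(1) by blast
  have hh: "h \<in> Hom C b (Cod C h)"
    using HomI[OF kernel_arr(2)[OF h]] kernel_arr(3)[OF h] HomD(3)[OF assms(3)] by simp
  note hD = kernelD[OF h hh]
  have fD: "Dom C f = a" using HomD[OF assms(3)] by simp
  have o: "b \<in> Obj C" "Cod C h \<in> Obj C" using HomD(4,5)[OF hh] by auto
  have "h \<cdot> f = Zero C b (Cod C h) \<cdot> f" using hD(2) Zero_Comp[OF assms(3) o(2)] fD by simp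
  then have "h = Zero C b (Cod C h)"
    using epi_cancel[OF assms(2,3) hh Zero_in[OF o]] by blast
  then have "h \<cdot> Id C b = Zero C b (Cod C h)" using Comp_Id[OF hh] by simp
  then show thesis using kernel_lift[OF h hh Id_in[OF o(1)]] that fD by blast
qed

lemma resolved_le_step:
  assumes s: "short_exact C f g" and X: "Dom C g \<in> X" and K: "Dom C f \<in> resolved_le C k X"
  shows "Cod C g \<in> resolved_le C (Suc k) X"
proof -
  note sD = short_exactD[OF s]
  obtain m d where d: "m \<le> k" "Cod C (d 0) = Dom C f" "is_epi C (d 0)"
    "\<And>i. i \<le> m \<Longrightarrow> Dom C (d i) \<in> X" "\<And>i. i < m \<Longrightarrow> exact_at C (d (Suc i)) (d i)" "is_mono C (d m)"
    using K unfolding resolved_le_def by blast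
  \<comment> \<open>Splicing: \<open>g\<close> is the new augmentation, the old one is composed with
    \<open>f\<close>, and the remaining arrows move up by one.\<close>
  define d' where "d' = case_nat g (case_nat (f \<cdot> d 0) (\<lambda>i. d (Suc i)))"
  have d0: "d 0 \<in> Hom C (Dom C (d 0)) (Dom C f)" 
    using d(2,3) HomI unfolding is_epi_def by metis
  note fd = Comp_in[OF d0 sD(1)]
  have d': "d' 0 = g" "d' (Suc 0) = f \<cdot> d 0" "\<And>i. d' (Suc (Suc i)) = d (Suc i)"
    by (simp_all add: d'_def)
  have "Dom C (d' i) \<in> X" if "i \<le> Suc m" for i
  proof -
    consider "i = 0" | "i = 1" | j where "i = Suc (Suc j)" by (metis One_nat_def not0_implies_Suc)
    then show ?thesis using that X d(4)[of 0] d(4)[of "i - 1"] d' HomD(2)[OF fd] by cases auto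
  qed
  moreover have "exact_at C (d' (Suc i)) (d' i)" if "i < Suc m" for i
  proof -
    consider "i = 0" | "i = 1" | j where "i = Suc (Suc j)" by (metis One_nat_def not0_implies_Suc)
    then show ?thesis
      using that d(5)[of "i - 1"] d' exact_at_comp_epi[OF d(3) d0 sD(1)] sD(8)
        exact_at_comp_mono[OF sD(4,1) d0] by cases auto
  qed
  moreover have "is_mono C (d' (Suc m))"
    using d(6) d' mono_comp[OF _ sD(4) d0 sD(1)] by (cases m) auto
  ultimately show ?thesis
    using d(1) d'(1) sD(5) HomD(5)[OF sD(2)] unfolding resolved_le_def
    by (intro CollectI conjI exI[of _ "Suc m"] exI[of _ d']) auto
qed

text \<open>A resolution with a single term has an invertible augmentation; this is recorded as a
  retract, the form in which Ext vanishing passes to \<open>c\<close>. A longer one is cut at the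
  kernel of its augmentation.\<close>

lemma resolved_le_cases:
  assumes "c \<in> resolved_le C k X"
  obtains (retract) x u v where "x \<in> X" "u \<in> Hom C c x" "v \<in> Hom C x c" "v \<cdot> u = Id C c"
  | (step) f g k' where "k = Suc k'" "short_exact C f g" "Cod C g = c" "Dom C g \<in> X"
      "Dom C f \<in> resolved_le C k' X"
proof -
  obtain m d where d: "m \<le> k" "Cod C (d 0) = c" "is_epi C (d 0)"
    "\<And>i. i \<le> m \<Longrightarrow> Dom C (d i) \<in> X" "\<And>i. i < m \<Longrightarrow> exact_at C (d (Suc i)) (d i)" "is_mono C (d m)"
    using assms unfolding resolved_le_def by blast
  have d0: "d 0 \<in> Hom C (Dom C (d 0)) c" 
    using d(2,3) HomI unfolding is_epi_def by metis
  show thesis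
  proof (cases m)
    case 0
    then obtain u where "u \<in> Hom C c (Dom C (d 0))" "d 0 \<cdot> u = Id C c"
      using iso_of_mono_epi[OF _ d(3) d0] d(6) by auto
    then show thesis using retract d(4)[of 0] d0 by blast
  next
    case (Suc m')
    obtain f e where fe: "is_kernel C f (d 0)" "is_epi C e" "is_mono C f"
      "f \<in> Hom C (Dom C f) (Dom C (d 0))" "e \<in> Hom C (Dom C (d (Suc 0))) (Dom C f)"
      "d (Suc 0) = f \<cdot> e"
      using exact_cofactor[OF d(5)[of 0]] Suc by blast
    \<comment> \<open>The epi part \<open>e\<close> of \<open>d 1\<close> augments the truncated
      resolution of the kernel \<open>Dom C f\<close>.\<close>
    define d' where "d' = case_nat e (\<lambda>i. d (Suc (Suc i)))"
    have d': "d' 0 = e" "\<And>i. d' (Suc i) = d (Suc (Suc i))" by (simp_all add: d'_def)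
    have "Dom C (d' i) \<in> X" if "i \<le> m'" for i
      using that d(4)[of "Suc i"] d' HomD(2)[OF fe(5)] Suc by (cases i) auto
    moreover have "exact_at C (d' (Suc i)) (d' i)" if "i < m'" for i
      using that d(5)[of "Suc i"] d' Suc exact_at_comp_mono[OF fe(3,4,5)] fe(6) by (cases i) auto
    moreover have "is_mono C (d' m')"
      using d(6) Suc d' mono_of_comp[OF _ fe(5,4)] fe(6) by (cases m') auto
    ultimately have "Dom C f \<in> resolved_le C (k - 1) X"
      unfolding resolved_le_def using d(1) d'(1) Suc fe(2) HomD(3)[OF fe(5)] HomD(4)[OF fe(4)]
      by (intro CollectI conjI exI[of _ m'] exI[of _ d']) auto
    then show thesis
      using step[of "k - 1" f "d 0"] short_exact_kernel[OF fe(1) d(3) d0] d(1,2) d(4)[of 0] Suc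
      by simp
  qed
qed

end

section \<open>Cotorsion pairs and cluster tilting\<close>

lemma (in category) Id_mono_epi:
  assumes "a \<in> Obj C"
  shows "is_mono C (Id C a)" "is_epi C (Id C a)"
proof -
  note i = Id_in[OF assms]
  note iD = HomD(1-3)[OF i]
  have "x = y" if "x \<in> Hom C b a" "y \<in> Hom C b a" "Id C a \<cdot> x = Id C a \<cdot> y" for x y b
    using that Id_Comp by metis
  then show "is_mono C (Id C a)" unfolding is_mono_def iD(2) using iD(1) by blast
  have "x = y" if "x \<in> Hom C a b" "y \<in> Hom C a b" "x \<cdot> Id C a = y \<cdot> Id C a" for x y b
    using that Comp_Id by metis
  then show "is_epi C (Id C a)" unfolding is_epi_def iD(3) using iD(1) by blast
qed

text \<open>For \<open>m = 0\<close> only \<open>d 0\<close> is constrained, so a constant family of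
  identities is a witness.\<close>

lemma (in category) subset_resolved_le_0:
  assumes "X \<subseteq> Obj C"
  shows "X \<subseteq> resolved_le C 0 X"
proof
  fix c assume c: "c \<in> X"
  then have o: "c \<in> Obj C" using assms by blast
  show "c \<in> resolved_le C 0 X"
    unfolding resolved_le_def using c o Id_mono_epi[OF o] HomD[OF Id_in[OF o]]
    by (intro CollectI conjI exI[of _ 0] exI[of _ "\<lambda>_. Id C c"]) auto
qed

text \<open>The splitting lemma: with a section \<open>u\<close> of \<open>g\<close>, the middle
  term is a biproduct of \<open>Cod C g\<close> and the kernel. The missing projection
  \<open>q\<close> comes from the complementary idempotent \<open>t\<close> of
  \<open>u \<cdot> g\<close>.\<close>

lemma (in abelian_category) split_summand:
  assumes s: "short_exact C f g" and u: "u \<in> Hom C (Cod C g) (Dom C g)" "g \<cdot> u = Id C (Cod C g)"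
    and "closed_under_summands C X" "Dom C g \<in> X"
  shows "Cod C g \<in> X"
proof -
  let ?K = "Dom C f" and ?A = "Dom C g" and ?c = "Cod C g"
  note sD = short_exactD[OF s]
  note ug = Comp_in[OF sD(2) u(1)]
  have o: "?K \<in> Obj C" "?A \<in> Obj C" "?c \<in> Obj C" using HomD(4,5)[OF sD(1)] HomD(5)[OF sD(2)] by auto
  note iA = Id_in[OF o(2)] and iK = Id_in[OF o(1)]
  obtain t where t: "t \<in> Hom C ?A ?A" "Id C ?A = Plus C t (u \<cdot> g)" using subtract[OF iA ug] .
  have "g = g \<cdot> Plus C t (u \<cdot> g)" using t(2) Comp_Id[OF sD(2)] by simp
  then have "Plus C (g \<cdot> t) g = g"
    using Plus_Comp[OF t(1) ug sD(2)] Comp_assoc[OF sD(2) u(1) sD(2)] u(2) Id_Comp[OF sD(2)] by simp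
  then have "g \<cdot> t = Zero C ?A ?c" using Plus_eq_right[OF Comp_in[OF t(1) sD(2)] sD(2)] by blast
  then obtain q where q: "q \<in> Hom C ?A ?K" "f \<cdot> q = t" using kernel_lift[OF sD(6,2) t(1)] by blast
  note gf = sD(3)
  have "f = Plus C t (u \<cdot> g) \<cdot> f" using t(2) Id_Comp[OF sD(1)] by simp
  also have "\<dots> = Plus C (t \<cdot> f) (u \<cdot> g \<cdot> f)" using Comp_Plus[OF sD(1) t(1) ug] .
  also have "u \<cdot> g \<cdot> f = Zero C ?K ?A"
    using Comp_assoc[OF sD(1,2) u(1)] gf Comp_Zero[OF u(1) o(1)] by simp
  finally have "f = t \<cdot> f" using Plus_Zero(1)[OF Comp_in[OF sD(1) t(1)]] by simp
  then have "f \<cdot> (q \<cdot> f) = f \<cdot> Id C ?K"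
    using Comp_assoc[OF sD(1) q(1) sD(1)] q(2) Comp_Id[OF sD(1)] by simp
  then have qf: "q \<cdot> f = Id C ?K"
    using mono_cancel[OF sD(4,1) Comp_in[OF sD(1) q(1)] iK] by blast
  have "u = Plus C t (u \<cdot> g) \<cdot> u" using t(2) Id_Comp[OF u(1)] by simp
  also have "\<dots> = Plus C (t \<cdot> u) (u \<cdot> g \<cdot> u)" using Comp_Plus[OF u(1) t(1) ug] .
  also have "u \<cdot> g \<cdot> u = u" using Comp_assoc[OF u(1) sD(2) u(1)] u(2) Comp_Id[OF u(1)] by simp
  finally have "t \<cdot> u = Zero C ?c ?A" using Plus_eq_right[OF Comp_in[OF u(1) t(1)] u(1)] by simp
  then have "f \<cdot> (q \<cdot> u) = f \<cdot> Zero C ?c ?K"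
    using Comp_assoc[OF u(1) q(1) sD(1)] q(2) Comp_Zero[OF sD(1) o(3)] by simp
  then have qu: "q \<cdot> u = Zero C ?c ?K"
    using mono_cancel[OF sD(4,1) Comp_in[OF u(1) q(1)] Zero_in[OF o(3,1)]] by blast
  \<comment> \<open>The definition of a biproduct wants the two summands of the identity in the
    other order.\<close>
  have comm: "Plus C (u \<cdot> g) (f \<cdot> q) = Id C ?A"
  proof -
    interpret comm_group "hom_group C ?A ?A" using hom_comm_group o(2) by blast
    show ?thesis using m_comm[of t "u \<cdot> g"] t q(2) ug by (simp add: hom_group_def)
  qed
  have "is_biproduct C ?c ?K ?A u f g q"
    unfolding is_biproduct_def using o u sD(1,2) q(1) qf qu gf comm by blast
  then show ?thesis using assms(4,5) unfolding closed_under_summands_def by blast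
qed

section \<open>Both implications of the equivalence, and finite resolutions of all objects\<close>

context abelian_category_enough
begin

text \<open>Induction on \<open>k\<close> by dimension shifting: the kernel of the augmentation has
  a shorter resolution but is needed one degree higher. Hence \<open>i\<close> is generalized, and
  the degrees from \<open>i + 1\<close> to \<open>i + k + 1\<close> are assumed to vanish on
  \<open>X\<close>.\<close>

lemma Ext_resolved_le:
  assumes a: "a \<in> Obj C" and X: "X \<subseteq> Obj C"
    and "c \<in> resolved_le C k X"
    and "\<And>x j. x \<in> X \<Longrightarrow> i \<le> j \<Longrightarrow> j \<le> i + k \<Longrightarrow> trivial_group (Ext C (Suc j) a x)"
  shows "trivial_group (Ext C (Suc i) a c)"
  using assms(3,4)
proof (induction k arbitrary: c i)
  case 0
  from 0(1) show ?case
  proof (cases rule: resolved_le_cases)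
    case (retract x u v)
    then show ?thesis using Ext_retract[OF a 0(2)] by simp
  qed simp
next
  case (Suc k)
  from Suc.prems(1) show ?case
  proof (cases rule: resolved_le_cases)
    case (retract x u v)
    then show ?thesis using Ext_retract[OF a Suc.prems(2)] by simp
  next
    case (step f g k')
    then have "trivial_group (Ext C (Suc (Suc i)) a (Dom C f))"
      using Suc.IH[of "Dom C f" "Suc i"] Suc.prems(2) by simp
    then show ?thesis using Ext_quotient[OF a step(2)] Suc.prems(2)[OF step(4)] step(3) by simp
  qed
qed

lemma cluster_tilting_half:
  assumes X: "X \<subseteq> Obj C" and n: "n \<ge> 1" and closed: "closed_under_summands C X"
    and "\<forall>a\<in>X. \<forall>b\<in>X. \<forall>i. 1 \<le> i \<and> i \<le> n \<longrightarrow> trivial_group (Ext C i a b)"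
    and approx: "\<forall>c\<in>Obj C. \<exists>f g. short_exact C f g \<and>
      Dom C f \<in> resolved_le C (n - 1) X \<and> Dom C g \<in> X \<and> Cod C g = c"
  shows "precovering C X" and "X = Obj C \<inter> (\<Inter>i\<in>{0<..<n + 1}. left_perp C i X)"
proof -
  have orth: "\<And>a b i. a \<in> X \<Longrightarrow> b \<in> X \<Longrightarrow> 1 \<le> i \<Longrightarrow> i \<le> n \<Longrightarrow> trivial_group (Ext C i a b)"
    using assms(4) by blast
  \<comment> \<open>The kernel has length at most \<open>n - 1\<close>, so vanishing on
    \<open>X\<close> in degrees 1 to \<open>n\<close> is exactly what kills its first Ext and
    permits lifting along \<open>g\<close>.\<close>
  have lift: "\<exists>y \<in> Hom C a (Dom C g). g \<cdot> y = x"
    if "short_exact C f g" "Dom C f \<in> resolved_le C (n - 1) X" "a \<in> Obj C" "x \<in> Hom C a (Cod C g)"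
      and v: "\<And>x i. x \<in> X \<Longrightarrow> 1 \<le> i \<Longrightarrow> i \<le> n \<Longrightarrow> trivial_group (Ext C i a x)" for a f g x
  proof -
    have "trivial_group (Ext C (Suc 0) a (Dom C f))"
      by (rule Ext_resolved_le[OF that(3) X that(2)]) (rule v, use n in auto)
    then show ?thesis using Ext_lift[OF that(3,1) _ that(4)] by auto
  qed
  show "precovering C X"
    unfolding precovering_def
  proof
    fix c assume "c \<in> Obj C"
    then obtain f g where fg: "short_exact C f g" "Dom C f \<in> resolved_le C (n - 1) X"
      "Dom C g \<in> X" "Cod C g = c"
      using approx by blast
    have "\<exists>h \<in> Hom C y (Dom C g). g \<cdot> h = x" if y: "y \<in> X" and x: "x \<in> Hom C y c" for y x
      by (rule lift[OF fg(1,2)]) (use y x fg(4) X orth[OF y] in auto)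
    then show "\<exists>x\<in>X. \<exists>f\<in>Hom C x c. \<forall>y\<in>X. \<forall>g\<in>Hom C y c. \<exists>h\<in>Hom C y x. f \<cdot> h = g"
      using fg(3,4) short_exactD(2)[OF fg(1)] by blast
  qed
  show "X = Obj C \<inter> (\<Inter>i\<in>{0<..<n + 1}. left_perp C i X)"
  proof
    show "X \<subseteq> Obj C \<inter> (\<Inter>i\<in>{0<..<n + 1}. left_perp C i X)"
      using X orth by (auto simp: left_perp_def)
    show "Obj C \<inter> (\<Inter>i\<in>{0<..<n + 1}. left_perp C i X) \<subseteq> X"
    proof
      fix c assume c: "c \<in> Obj C \<inter> (\<Inter>i\<in>{0<..<n + 1}. left_perp C i X)"
      then have co: "c \<in> Obj C" by blast
      have v: "trivial_group (Ext C i c x)" if "x \<in> X" "1 \<le> i" "i \<le> n" for x i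
      proof -
        have "i \<in> {0<..<n + 1}" using that(2,3) by simp
        then have "c \<in> left_perp C i X" using c by blast
        then show ?thesis using that(1) unfolding left_perp_def by blast
      qed
      obtain f g where fg: "short_exact C f g" "Dom C f \<in> resolved_le C (n - 1) X"
        "Dom C g \<in> X" "Cod C g = c"
        using approx co by blast
      \<comment> \<open>Lifting the identity splits the approximation and makes \<open>c\<close> a
        summand of \<open>Dom C g\<close>.\<close>
      have "Id C c \<in> Hom C c (Cod C g)" using fg(4) Id_in[OF co] by simp
      then obtain u where "u \<in> Hom C c (Dom C g)" "g \<cdot> u = Id C c"
        using lift[OF fg(1,2) co _ v] by blast
      then show "c \<in> X" using split_summand[OF fg(1) _ _ closed fg(3)] fg(4) by simp
    qed
  qed
qed

lemma cotorsion_half: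
  assumes n: "n \<ge> 1" and pre: "precovering C X"
    and left: "X = Obj C \<inter> (\<Inter>i\<in>{0<..<n + 1}. left_perp C i X)"
    and right: "X = Obj C \<inter> (\<Inter>i\<in>{0<..<n + 1}. right_perp C i X)"
  shows "\<forall>c\<in>Obj C. \<exists>f g. short_exact C f g \<and>
      Dom C f \<in> resolved_le C (n - 1) X \<and> Dom C g \<in> X \<and> Cod C g = c"
proof -
  have X: "X \<subseteq> Obj C" using left by blast
  have orth: "trivial_group (Ext C i a b)" if "a \<in> X" "b \<in> X" "1 \<le> i" "i \<le> n" for a b i
  proof -
    have "i \<in> {0<..<n + 1}" using that(3,4) by simp
    then have "a \<in> left_perp C i X" using left that(1) by blast
    then show ?thesis using that(2) unfolding left_perp_def by blast
  qed
  have mem: "c \<in> X"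
    if "c \<in> Obj C" "\<And>x i. x \<in> X \<Longrightarrow> 1 \<le> i \<Longrightarrow> i \<le> n \<Longrightarrow> trivial_group (Ext C i x c)" for c
  proof -
    have "c \<in> right_perp C i X" if "i \<in> {0<..<n + 1}" for i
      using that \<open>c \<in> Obj C\<close> that(1) \<open>\<And>x i. x \<in> X \<Longrightarrow> 1 \<le> i \<Longrightarrow> i \<le> n \<Longrightarrow> trivial_group (Ext C i x c)\<close>
      unfolding right_perp_def by auto
    then show ?thesis using right \<open>c \<in> Obj C\<close> by blast
  qed
  \<comment> \<open>Projectives are left orthogonal to everything; having them in \<open>X\<close>
    is what makes precovers epi.\<close>
  have proj: "p \<in> X" if p: "is_projective C p" for p
  proof -
    have po: "p \<in> Obj C" using p unfolding is_projective_def by blast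
    have "p \<in> left_perp C i X" if i: "i \<in> {0<..<n + 1}" for i
    proof -
      obtain j where "i = Suc j" using i by (cases i) auto
      then show ?thesis using po Ext_projective[OF p] X unfolding left_perp_def by blast
    qed
    then show ?thesis using left po by blast
  qed
  have ses: "\<exists>f g. short_exact C f g \<and> Dom C g \<in> X \<and> Cod C g = c \<and>
      (\<forall>y\<in>X. \<forall>x\<in>Hom C y c. \<exists>h\<in>Hom C y (Dom C g). g \<cdot> h = x)" if c: "c \<in> Obj C" for c
  proof -
    obtain x g where xg: "x \<in> X" "g \<in> Hom C x c"
      "\<And>y t. y \<in> X \<Longrightarrow> t \<in> Hom C y c \<Longrightarrow> \<exists>h\<in>Hom C y x. g \<cdot> h = t"
      using pre c unfolding precovering_def by blast
    obtain p e where pe: "is_projective C p" "e \<in> Hom C p c" "is_epi C e"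
      using enough_proj c unfolding enough_projectives_def by blast
    \<comment> \<open>An epi from a projective factors through the precover \<open>g\<close>, so
      \<open>g\<close> is epi too.\<close>
    obtain h where h: "h \<in> Hom C p x" "g \<cdot> h = e" using xg(3)[OF proj[OF pe(1)] pe(2)] by blast
    have epi: "is_epi C g" using epi_of_comp[OF _ h(1) xg(2)] h(2) pe(3) by simp
    obtain f where f: "is_kernel C f g" using ex_kernel HomD(1)[OF xg(2)] by blast
    have "short_exact C f g" using short_exact_kernel[OF f epi xg(2)] .
    then show ?thesis using xg HomD(2,3)[OF xg(2)] by blast
  qed
  \<comment> \<open>Vanishing for \<open>c\<close> up to degree \<open>j\<close> yields vanishing
    for the kernel up to degree \<open>j + 1\<close>, capped at \<open>n\<close>. Degree 1 comes
    from the precover property, degree \<open>i\<close> above it from degree \<open>i - 1\<close> of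
    \<open>c\<close>.\<close>
  have gain: "trivial_group (Ext C i x (Dom C f))"
    if s: "short_exact C f g" "Dom C g \<in> X" "Cod C g = c"
      "\<forall>y\<in>X. \<forall>x\<in>Hom C y c. \<exists>h\<in>Hom C y (Dom C g). g \<cdot> h = x"
      and v: "\<And>x i. x \<in> X \<Longrightarrow> 1 \<le> i \<Longrightarrow> i \<le> j \<Longrightarrow> trivial_group (Ext C i x c)"
      and i: "x \<in> X" "1 \<le> i" "i \<le> Suc j" "i \<le> n" for c j x i f g
  proof -
    have x: "x \<in> Obj C" using i(1) X by blast
    consider "i = 1" | i' where "i = Suc (Suc i')"
      using i(2) by (metis One_nat_def Suc_le_D not0_implies_Suc)
    then show ?thesis
    proof cases
      case 1
      then show ?thesis using Ext_sub_1[OF x s(1)] orth[OF i(1) s(2)] n s(3,4) i(1) by simp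
    next
      case (2 i')
      then show ?thesis
        using Ext_sub_Suc[OF x s(1)] orth[OF i(1) s(2)] v[OF i(1), of "Suc i'"] s(3) i(3,4) by simp
    qed
  qed
  \<comment> \<open>Here \<open>k\<close> counts the missing degrees: each precover supplies one,
    and for \<open>k = 0\<close> the object lies in \<open>X\<close>.\<close>
  have res: "c \<in> resolved_le C k X"
    if "k \<le> n" "c \<in> Obj C"
      "\<And>x i. x \<in> X \<Longrightarrow> 1 \<le> i \<Longrightarrow> i \<le> n - k \<Longrightarrow> trivial_group (Ext C i x c)" for c k
    using that
  proof (induction k arbitrary: c)
    case 0
    then show ?case using mem[of c] subset_resolved_le_0[OF X] by auto
  next
    case (Suc k)
    obtain f g where fg: "short_exact C f g" "Dom C g \<in> X" "Cod C g = c"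
      "\<forall>y\<in>X. \<forall>x\<in>Hom C y c. \<exists>h\<in>Hom C y (Dom C g). g \<cdot> h = x"
      using ses[OF Suc.prems(2)] by blast
    have "trivial_group (Ext C i x (Dom C f))" if "x \<in> X" "1 \<le> i" "i \<le> n - k" for x i
      by (rule gain[OF fg Suc.prems(3)]) (use that in auto)
    then have "Dom C f \<in> resolved_le C k X"
      using Suc.IH[of "Dom C f"] Suc.prems(1) HomD(4)[OF short_exactD(1)[OF fg(1)]] by simp
    then show ?case using resolved_le_step[OF fg(1,2)] fg(3) by simp
  qed
  show ?thesis
  proof
    fix c assume c: "c \<in> Obj C"
    obtain f g where fg: "short_exact C f g" "Dom C g \<in> X" "Cod C g = c"
      "\<forall>y\<in>X. \<forall>x\<in>Hom C y c. \<exists>h\<in>Hom C y (Dom C g). g \<cdot> h = x"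
      using ses[OF c] by blast
    \<comment> \<open>With \<open>j = 0\<close> the assumption on \<open>c\<close> is vacuous. The
      kernel gains degree 1, the only one in the range as \<open>n - (n - 1) = 1\<close>.\<close>
    have "trivial_group (Ext C i x (Dom C f))" if "x \<in> X" "1 \<le> i" "i \<le> n - (n - 1)" for x i
      by (rule gain[OF fg, of 0]) (use that n in auto)
    then have "Dom C f \<in> resolved_le C (n - 1) X"
      using res[of "n - 1" "Dom C f"] HomD(4)[OF short_exactD(1)[OF fg(1)]] by simp
    then show "\<exists>f g. short_exact C f g \<and>
      Dom C f \<in> resolved_le C (n - 1) X \<and> Dom C g \<in> X \<and> Cod C g = c"
      using fg by blast
  qed
qed

text \<open>A summand is a retract, and vanishing of Ext in the second argument passes to
  retracts.\<close>

lemma closed_under_summands_right_perp: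
  assumes X: "X \<subseteq> Obj C" and right: "X = Obj C \<inter> (\<Inter>i\<in>{0<..<m}. right_perp C i X)"
  shows "closed_under_summands C X"
  unfolding closed_under_summands_def
proof (intro ballI allI impI)
  fix s a b i j p q
  assume s: "s \<in> X" and "is_biproduct C a b s i j p q"
  then have h: "i \<in> Hom C a s" "p \<in> Hom C s a" "p \<cdot> i = Id C a" unfolding is_biproduct_def by auto
  have "a \<in> right_perp C k X" if k: "k \<in> {0<..<m}" for k
  proof -
    obtain l where l: "k = Suc l" using k by (cases k) auto
    have "s \<in> right_perp C k X" using right s k by blast
    then show ?thesis
      using Ext_retract[OF _ _ h] X HomD(4)[OF h(1)] l unfolding right_perp_def by blast
  qed
  then show "a \<in> X" using right HomD(4)[OF h(1)] by blast
qed

lemma n_cotorsion_pair_iff_cluster_tilting: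
  assumes X: "X \<subseteq> Obj C" and n: "n \<ge> 1"
  shows "n_cotorsion_pair C n X X \<longleftrightarrow> cluster_tilting C (n + 1) X"
proof
  interpret op: abelian_category_enough "op_cat C" by (rule enough_op)
  \<comment> \<open>The symmetry of Ext is stated for successors, whence the index
    \<open>i - 1\<close> for positive \<open>i\<close>.\<close>
  have p: "left_perp (op_cat C) i X = right_perp C i X"
    "right_perp (op_cat C) i X = left_perp C i X" if "i \<in> {0<..<n + 1}" for i
    using left_perp_op[OF X, of "i - 1"] that by simp_all
  have perp: "(\<Inter>i\<in>{0<..<n + 1}. left_perp (op_cat C) i X) = (\<Inter>i\<in>{0<..<n + 1}. right_perp C i X)"
    "(\<Inter>i\<in>{0<..<n + 1}. right_perp (op_cat C) i X) = (\<Inter>i\<in>{0<..<n + 1}. left_perp C i X)"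
    using p by simp_all
  {
    assume "n_cotorsion_pair C n X X"
    then have closed: "closed_under_summands C X"
      and orth: "\<forall>a\<in>X. \<forall>b\<in>X. \<forall>i. 1 \<le> i \<and> i \<le> n \<longrightarrow> trivial_group (Ext C i a b)"
      and l: "\<forall>c\<in>Obj C. \<exists>f g. short_exact C f g \<and>
        Dom C f \<in> resolved_le C (n - 1) X \<and> Dom C g \<in> X \<and> Cod C g = c"
      and r: "\<forall>c\<in>Obj C. \<exists>f g. short_exact C f g \<and>
        Dom C f = c \<and> Cod C f \<in> X \<and> Cod C g \<in> coresolved_le C (n - 1) X"
      unfolding n_cotorsion_pair_def by blast+
    have orth_op: "\<forall>a\<in>X. \<forall>b\<in>X. \<forall>i. 1 \<le> i \<and> i \<le> n \<longrightarrow> trivial_group (Ext (op_cat C) i a b)"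
    proof (intro ballI allI impI)
      fix a b i
      assume ab: "a \<in> X" "b \<in> X" and i: "1 \<le> i \<and> i \<le> n"
      have "a \<in> Obj C" "b \<in> Obj C" using ab X by blast+
      moreover obtain j where "i = Suc j" using i by (cases i) auto
      moreover have "trivial_group (Ext C i b a)" using orth ab i by blast
      ultimately show "trivial_group (Ext (op_cat C) i a b)" using Ext_trivial_op[of b a j] by simp
    qed
    \<comment> \<open>The coapproximations, with the names of the arrows exchanged, have the form of
      approximations in \<open>op_cat C\<close>.\<close>
    have "\<forall>c\<in>Obj C. \<exists>f g. short_exact C g f \<and>
        Cod C f \<in> coresolved_le C (n - 1) X \<and> Cod C g \<in> X \<and> Dom C g = c"
    proof
      fix c assume "c \<in> Obj C"
      with r obtain f g where "short_exact C f g" "Dom C f = c" "Cod C f \<in> X"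
        "Cod C g \<in> coresolved_le C (n - 1) X" by blast
      then show "\<exists>f g. short_exact C g f \<and>
        Cod C f \<in> coresolved_le C (n - 1) X \<and> Cod C g \<in> X \<and> Dom C g = c" by blast
    qed
    note half_op = op.cluster_tilting_half[of X n, unfolded op_cat_simps precovering_op perp
        closed_under_summands_op short_exact_op resolved_le_op, OF X n closed orth_op this]
    show "cluster_tilting C (n + 1) X"
      unfolding cluster_tilting_def
      using cluster_tilting_half[OF X n closed orth l] half_op by (intro conjI)
  }
  {
    assume "cluster_tilting C (n + 1) X"
    then have pre: "precovering C X" and pe: "preenveloping C X"
      and left: "X = Obj C \<inter> (\<Inter>i\<in>{0<..<n + 1}. left_perp C i X)"
      and right: "X = Obj C \<inter> (\<Inter>i\<in>{0<..<n + 1}. right_perp C i X)"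
      unfolding cluster_tilting_def by blast+
    have orth: "\<forall>a\<in>X. \<forall>b\<in>X. \<forall>i. 1 \<le> i \<and> i \<le> n \<longrightarrow> trivial_group (Ext C i a b)"
    proof (intro ballI allI impI)
      fix a b i assume "a \<in> X" "b \<in> X" "1 \<le> i \<and> i \<le> n"
      then have "i \<in> {0<..<n + 1}" by simp
      then have "a \<in> left_perp C i X" using left \<open>a \<in> X\<close> by blast
      then show "trivial_group (Ext C i a b)" using \<open>b \<in> X\<close> unfolding left_perp_def by blast
    qed
    \<comment> \<open>In the opposite category \<open>left\<close> and \<open>right\<close> exchange
      roles, and the kernel of a precover becomes the cokernel of a preenvelope.\<close>
    have "\<forall>c\<in>Obj C. \<exists>f g. short_exact C g f \<and>
        Cod C f \<in> coresolved_le C (n - 1) X \<and> Cod C g \<in> X \<and> Dom C g = c"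
      using op.cotorsion_half[of n X, unfolded op_cat_simps precovering_op perp short_exact_op
          resolved_le_op, OF n pe right left] .
    note r = this
    have "\<forall>c\<in>Obj C. \<exists>f g. short_exact C f g \<and>
        Dom C f = c \<and> Cod C f \<in> X \<and> Cod C g \<in> coresolved_le C (n - 1) X"
    proof
      fix c assume "c \<in> Obj C"
      with r obtain f g where "short_exact C g f" "Cod C f \<in> coresolved_le C (n - 1) X"
        "Cod C g \<in> X" "Dom C g = c" by blast
      then show "\<exists>f g. short_exact C f g \<and>
        Dom C f = c \<and> Cod C f \<in> X \<and> Cod C g \<in> coresolved_le C (n - 1) X" by blast
    qed
    note r = this and c = closed_under_summands_right_perp[OF X right]
    show "n_cotorsion_pair C n X X"
      unfolding n_cotorsion_pair_def
      by (intro conjI X c orth cotorsion_half[OF n pre left right] r)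
  }
qed

text \<open>Splicing the approximation with the resolution of its kernel adds one term, and
  \<open>n = Suc (n - 1)\<close>.\<close>

lemma resolved_le_of_approx:
  assumes "n \<ge> 1" and approx: "\<forall>c\<in>Obj C. \<exists>f g. short_exact C f g \<and>
      Dom C f \<in> resolved_le C (n - 1) X \<and> Dom C g \<in> X \<and> Cod C g = c"
  shows "Obj C = resolved_le C n X"
proof
  show "resolved_le C n X \<subseteq> Obj C" unfolding resolved_le_def by blast
  show "Obj C \<subseteq> resolved_le C n X"
  proof
    fix c assume "c \<in> Obj C"
    then obtain f g where fg: "short_exact C f g" "Dom C f \<in> resolved_le C (n - 1) X"
      "Dom C g \<in> X" "Cod C g = c"
      using approx by blast
    show "c \<in> resolved_le C n X" using resolved_le_step[OF fg(1,3,2)] fg(4) assms(1) by simp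
  qed
qed

end

theorem theorem5p26:
  fixes C :: "('o, 'm, 'x) precat_scheme" and D :: "'o set" and n :: nat
  assumes "abelian_category C"
    and "enough_projectives C"
    and "enough_injectives C"
    and "D \<subseteq> Obj C"
    and "n \<ge> 1"
  shows "(n_cotorsion_pair C n D D \<longleftrightarrow> cluster_tilting C (n + 1) D) \<and>
    (n_cotorsion_pair C n D D \<or> cluster_tilting C (n + 1) D \<longrightarrow>
      Obj C = resolved_le C n D \<and> Obj C = coresolved_le C n D)"
proof -
  interpret C: abelian_category_enough C
    using assms(1-3) by (simp add: abelian_category_enough_def abelian_category_enough_axioms_def)
  interpret op: abelian_category_enough "op_cat C" by (rule C.enough_op)
  have iff: "n_cotorsion_pair C n D D \<longleftrightarrow> cluster_tilting C (n + 1) D"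
    by (rule C.n_cotorsion_pair_iff_cluster_tilting[OF assms(4,5)])
  \<comment> \<open>By the equivalence it suffices to treat the cotorsion case.\<close>
  have "Obj C = resolved_le C n D \<and> Obj C = coresolved_le C n D" if "n_cotorsion_pair C n D D"
  proof
    have l: "\<forall>c\<in>Obj C. \<exists>f g. short_exact C f g \<and>
        Dom C f \<in> resolved_le C (n - 1) D \<and> Dom C g \<in> D \<and> Cod C g = c"
      and r': "\<forall>c\<in>Obj C. \<exists>f g. short_exact C f g \<and>
        Dom C f = c \<and> Cod C f \<in> D \<and> Cod C g \<in> coresolved_le C (n - 1) D"
      using that unfolding n_cotorsion_pair_def by blast+
    have r: "\<forall>c\<in>Obj C. \<exists>f g. short_exact C g f \<and>
        Cod C f \<in> coresolved_le C (n - 1) D \<and> Cod C g \<in> D \<and> Dom C g = c"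
    proof
      fix c assume "c \<in> Obj C"
      with r' obtain f g where "short_exact C f g" "Dom C f = c" "Cod C f \<in> D"
        "Cod C g \<in> coresolved_le C (n - 1) D" by blast
      then show "\<exists>f g. short_exact C g f \<and>
        Cod C f \<in> coresolved_le C (n - 1) D \<and> Cod C g \<in> D \<and> Dom C g = c" by blast
    qed
    show "Obj C = resolved_le C n D" by (rule C.resolved_le_of_approx[OF assms(5) l])
    show "Obj C = coresolved_le C n D"
      using op.resolved_le_of_approx[OF assms(5), unfolded op_cat_simps C.short_exact_op
          C.resolved_le_op, OF r] .
  qed
  then show ?thesis using iff by blast
qed

end
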